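(* Let $a$ and $j$ be integers with $a\ge 2$ and $0\le j\le a-1$. Let $q$ and $z$ be complex numbers with $0<|q|<1$ and $z\ne 0$. Then $$\sum_{\substack{\vec n=(n_0,n_1,\dots,n_{a-1})\in\mathbb{Z}^a\\ \vec n\cdot\vec 1_a=0}} z^{n_j}\,\omega_a^{\vec b_a\cdot\vec n}\,q^{\frac12\vec n\cdot\vec n} \;=\; E(q)^{a-2}E(q^a)\prod_{n=1}^\infty\frac{(1-zq^{n-1})(1-z^{-1}q^n)}{(1-zq^{a(n-1)})(1-z^{-1}q^{an})}.$$
   Context: $E(q):=\prod_{n=1}^\infty(1-q^n)$. $\omega_a:=\exp(2\pi i/a)$. $\vec 1_a=(1,1,\dots,1)\in\mathbb{Z}^a$, $\vec b_a=(0,1,2,\dots,a-1)\in\mathbb{Z}^a$, and $\cdot$ is the standard dot product. On the right-hand side every denominator factor also occurs as a numerator factor, and the quotient is understood after cancelling (removable singularities), so that the right side is analytic for all $z\neq0$. *)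

theory Defs
  imports "HOL-Complex_Analysis.Complex_Analysis"
begin

definition euler_E :: "complex \<Rightarrow> complex" where
  "euler_E q = (\<Prod>n. 1 - q ^ Suc n)"

definition omega :: "nat \<Rightarrow> complex" where
  "omega a = exp (2 * of_real pi * \<i> / of_nat a)"

text \<open>
  Vectors in \<open>\<int>\<^sup>a\<close> are functions on \<open>{..<a}\<close>, made \<open>undefined\<close> elsewhere so that
  each vector is represented exactly once.
\<close>

definition dot :: "nat \<Rightarrow> (nat \<Rightarrow> int) \<Rightarrow> (nat \<Rightarrow> int) \<Rightarrow> int" where
  "dot a u v = (\<Sum>i<a. u i * v i)"

definition ones_vec :: "nat \<Rightarrow> int" where
  "ones_vec i = 1"

definition b_vec :: "nat \<Rightarrow> int" where
  "b_vec i = int i"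

definition zero_sum_vecs :: "nat \<Rightarrow> (nat \<Rightarrow> int) set" where
  "zero_sum_vecs a = {n \<in> {..<a} \<rightarrow>\<^sub>E UNIV. dot a n ones_vec = 0}"

text \<open>
  On \<^const>\<open>zero_sum_vecs\<close> the number \<open>n \<cdot> n\<close> is even, having the parity of the
  coordinate sum, so the integer division below is exact.
\<close>

definition theta_term :: "nat \<Rightarrow> nat \<Rightarrow> complex \<Rightarrow> complex \<Rightarrow> (nat \<Rightarrow> int) \<Rightarrow> complex" where
  "theta_term a j q z n =
     z powi (n j) * omega a powi (dot a b_vec n) * q powi (dot a n n div 2)"

text \<open>
  The index \<open>n\<close> starts at 0 here, i.e. it is shifted by one against the usual product from 1.
  Where a denominator factor vanishes, this function takes a junk value (division by zero is zero).
  These points are removable singularities, isolated in \<open>- {0}\<close>; \<^const>\<open>remove_sings\<close> replaces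
  the value at each point by the limit there, which at all other points of \<open>- {0}\<close> is the
  original value.
\<close>

definition product_side :: "nat \<Rightarrow> complex \<Rightarrow> complex \<Rightarrow> complex" where
  "product_side a q z =
     euler_E q ^ (a - 2) * euler_E (q ^ a) *
     (\<Prod>n. ((1 - z * q ^ n) * (1 - inverse z * q ^ Suc n)) /
            ((1 - z * q ^ (a * n)) * (1 - inverse z * q ^ (a * Suc n))))"

end

theory Submission
  imports Defs
begin

text \<open>
  Let \<open>f z\<close> be the left-hand side and \<open>\<theta>(z; q) = (\<Prod>n. (1 - z q^n) (1 - q^(n+1) / z))\<close>.
  Translating the summation vector gives \<open>f\<close> the same multiplier under \<open>z \<mapsto> q^a z\<close> as
  \<open>\<theta>(z; q) / \<theta>(z; q^a)\<close>. At \<open>z = q^m\<close> a translation turns \<open>f\<close> into a sum over the vectors with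
  coordinate sum \<open>m\<close>, which a cyclic shift of the coordinates multiplies by \<open>\<omega>^m\<close>; hence it vanishes
  unless \<open>a\<close> divides \<open>m\<close>. As \<open>\<theta>(z; q)\<close> has only simple zeros, at the powers of \<open>q\<close>, the quotient
  \<open>f z \<theta>(z; q^a) / \<theta>(z; q)\<close> is holomorphic on \<open>- {0}\<close> and invariant under \<open>z \<mapsto> q^a z\<close>, so it is
  constant by Liouville's theorem. Letting \<open>z\<close> tend to 1 leaves \<open>f 1 = E(q)^a / E(q^a)\<close>, which is
  obtained by splitting the product of the series \<open>\<Sum>k. \<omega>^(i k) s^(k\<^sup>2)\<close> over \<open>i < a\<close> (where \<open>q = s\<^sup>2\<close>)
  according to the coordinate sum and evaluating both sides by the Jacobi triple product.
\<close>

section \<open>Infinite products\<close>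

text \<open>The infinite q-Pochhammer symbol \<open>(w; q)_\<infinity>\<close>.\<close>

definition qpoch :: "complex \<Rightarrow> complex \<Rightarrow> complex" where
  "qpoch w q = (\<Prod>n. 1 - w * q ^ n)"

lemma summable_qpoch: "norm q < 1 \<Longrightarrow> summable (\<lambda>n. norm (w * q ^ n))" for q w :: complex
  by (auto simp: norm_mult norm_power intro!: summable_mult summable_geometric)

lemma convergent_prod_qpoch:
  assumes "norm q < 1"
  shows "convergent_prod (\<lambda>n. 1 - w * q ^ n :: complex)"
proof -
  have "abs_convergent_prod (\<lambda>n. 1 - w * q ^ n)"
    using summable_qpoch[OF assms, of w] by (simp add: abs_convergent_prod_conv_summable)
  thus ?thesis by (rule abs_convergent_prod_imp_convergent_prod)
qed

lemma has_prod_qpoch: "norm q < 1 \<Longrightarrow> (\<lambda>n. 1 - w * q ^ n) has_prod qpoch w q"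
  unfolding qpoch_def by (intro convergent_prod_has_prod convergent_prod_qpoch)

lemma qpoch_lim: "norm q < 1 \<Longrightarrow> (\<lambda>n. \<Prod>k<n. 1 - w * q ^ k) \<longlonglongrightarrow> qpoch w q"
  by (metis has_prod_imp_tendsto' has_prod_qpoch)

lemma qpoch_eq_0_iff: "norm q < 1 \<Longrightarrow> qpoch w q = 0 \<longleftrightarrow> (\<exists>n. w * q ^ n = 1)"
  using has_prod_eq_0_iff[OF has_prod_qpoch, of q w] by (force simp: image_iff)

text \<open>Splitting off the factor for \<open>n = 0\<close>; the functional equation of theta
  rests on this.\<close>

lemma qpoch_rec:
  assumes "norm q < 1"
  shows "qpoch w q = (1 - w) * qpoch (w * q) q"
proof -
  have "(\<lambda>n. \<Prod>k<Suc n. 1 - w * q ^ k) \<longlonglongrightarrow> qpoch w q"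
    using qpoch_lim[OF assms] by (rule LIMSEQ_Suc)
  moreover have "(\<lambda>n. (1 - w) * (\<Prod>k<n. 1 - w * q * q ^ k)) \<longlonglongrightarrow> (1 - w) * qpoch (w * q) q"
    by (intro tendsto_intros qpoch_lim assms)
  moreover have "(\<Prod>k<Suc n. 1 - w * q ^ k) = (1 - w) * (\<Prod>k<n. 1 - w * q * q ^ k)" for n
    by (simp add: prod.lessThan_Suc_shift mult.assoc del: prod.lessThan_Suc)
  ultimately show ?thesis
    using LIMSEQ_unique by simp
qed

lemma euler_E_eq_qpoch: "euler_E q = qpoch q q"
  by (simp add: euler_E_def qpoch_def)

lemma euler_E_nonzero:
  assumes "norm q < 1" shows "euler_E q \<noteq> 0"
proof
  assume "euler_E q = 0"
  then obtain n where "q * q ^ n = 1"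
    using assms by (auto simp: euler_E_eq_qpoch qpoch_eq_0_iff)
  hence "norm (q ^ Suc n) = 1" by simp
  hence "norm q ^ Suc n = 1" by (simp only: norm_power)
  moreover have "norm q ^ Suc n < 1" using assms by (subst power_less_one_iff) auto
  ultimately show False by simp
qed

text \<open>On a unit disc around \<open>w\<close> the deviations of the factors from 1 are
  dominated by a geometric series, so the partial products converge uniformly there. The form with
  an inner function \<open>f\<close> suits automatic composition.\<close>

lemma qpoch_holomorphic [holomorphic_intros]:
  assumes q: "norm q < 1" and f: "f holomorphic_on A"
  shows "(\<lambda>z. qpoch (f z) q) holomorphic_on A"
proof -
  have "(\<lambda>w. qpoch w q) holomorphic_on UNIV"
  proof (rule holomorphic_onI)
    fix w :: complex
    let ?K = "cball w 1"
    have "uniformly_convergent_on ?K (\<lambda>N w. \<Prod>n<N. 1 - w * q ^ n)"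
    proof (rule uniformly_convergent_on_prod')
      show "uniformly_convergent_on ?K (\<lambda>N w. \<Sum>n<N. norm (1 - w * q ^ n - 1))"
      proof (rule Weierstrass_m_test')
        fix n x assume "x \<in> ?K"
        hence "norm x \<le> norm w + 1"
          using norm_triangle_ineq2[of x w] by (simp add: dist_norm norm_minus_commute)
        thus "norm (norm (1 - x * q ^ n - 1)) \<le> (norm w + 1) * norm q ^ n"
          by (simp add: norm_mult norm_power mult_right_mono)
      next
        show "summable (\<lambda>n. (norm w + 1) * norm q ^ n)"
          using q by (intro summable_mult summable_geometric) auto
      qed
    qed (auto intro!: continuous_intros)
    then obtain l where l: "uniform_limit ?K (\<lambda>N w. \<Prod>n<N. 1 - w * q ^ n) l sequentially"
      by (auto simp: uniformly_convergent_on_def)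
    have leq: "l x = qpoch x q" if "x \<in> ?K" for x
      using tendsto_uniform_limitI[OF l that] qpoch_lim[OF q, of x] LIMSEQ_unique by blast
    have "l holomorphic_on ball w 1"
      by (rule holomorphic_uniform_limit[OF _ l])
         (auto intro!: always_eventually continuous_intros holomorphic_intros)
    hence "(\<lambda>w. qpoch w q) holomorphic_on ball w 1"
      by (rule holomorphic_transform) (auto simp: leq)
    thus "(\<lambda>w. qpoch w q) field_differentiable at w within UNIV"
      by (simp add: holomorphic_on_imp_differentiable_at)
  qed
  from holomorphic_on_compose_gen[OF f this] show ?thesis
    by (simp add: o_def)
qed

section \<open>The Jacobi triple product\<close>

text \<open>Induction on \<open>M\<close> by the q-Pascal rule:
  \<open>p M / (p j * p (M - j))\<close> is the Gaussian binomial coefficient, and the new factor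
  \<open>1 + y * q ^ M\<close> mixes neighbouring coefficients.\<close>

lemma q_binomial_theorem:
  fixes y q :: complex
  defines "p \<equiv> \<lambda>n. \<Prod>k<n. 1 - q ^ Suc k"
  assumes nz: "\<And>n. p n \<noteq> 0"
  shows "(\<Prod>k<M. 1 + y * q ^ k) = (\<Sum>j\<le>M. p M / (p j * p (M - j)) * q ^ (j * (j - 1) div 2) * y ^ j)"
proof (induction M)
  case 0 show ?case using nz[of 0] by (simp add: p_def)
next
  case (Suc M)
  \<comment> \<open>The coefficients are continued by 0 beyond \<open>j = M\<close>, so that the
    recurrence also covers the top index and the sum may run to \<open>Suc M\<close>.\<close>
  define c where "c M j = (if j \<le> M then p M / (p j * p (M - j)) * q ^ (j * (j - 1) div 2) else 0)" for M j
  have psuc: "p (Suc n) = p n * (1 - q ^ Suc n)" for n by (simp add: p_def)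
  have nz': "1 - q ^ Suc n \<noteq> 0" for n using nz[of "Suc n"] by (simp add: psuc)
  have tri: "(Suc i * (Suc i - 1) div 2) = (i * (i - 1) div 2) + i" for i
  proof -
    have "Suc i * (Suc i - 1) = i * (i - 1) + 2 * i" by (cases i) auto
    thus ?thesis by simp
  qed
  have p0: "p 0 = 1" by (simp add: p_def)
  have step: "c (Suc M) (Suc i) = c M (Suc i) + q ^ M * c M i" if "i \<le> M" for i
  proof (cases "i = M")
    case True
    have "Suc M * (Suc M - Suc 0) div 2 = (M * (M - 1) div 2) + M" using tri[of M] by simp
    thus ?thesis using True nz[of M] nz[of "Suc M"] p0 by (simp add: c_def power_add)
  next
    case False
    with that have "i < M" by simp
    then obtain d where d: "M = Suc (i + d)" using less_iff_Suc_add by auto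
    have qM: "q ^ M = q ^ i * q ^ Suc d" by (simp add: d power_add)
    have qM': "q ^ Suc M = q ^ Suc i * q ^ Suc d" by (simp add: d power_add)
    \<comment> \<open>With \<open>u\<close> and \<open>v\<close> as atoms, clearing denominators
      reduces the q-Pascal rule to \<open>1 - u * v = (1 - v) + v * (1 - u)\<close>.\<close>
    define u where "u = q ^ Suc i"
    define v where "v = q ^ Suc d"
    define t where "t = q ^ (i * (i - 1) div 2)"
    define A where "A = p M" define B where "B = p i" define C where "C = p d"
    have nzz: "B \<noteq> 0" "C \<noteq> 0" "1 - u \<noteq> 0" "1 - v \<noteq> 0"
      using nz nz' by (auto simp: B_def C_def u_def v_def)
    have d1: "M - i = Suc d" "M - Suc i = d" "Suc M - Suc i = Suc d"
      using d by auto
    have tt: "q ^ (Suc i * (Suc i - 1) div 2) = t * q ^ i"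
      unfolding tri by (simp add: t_def power_add)
    have c1: "c (Suc M) (Suc i) = A * (1 - u * v) / (B * (1 - u) * (C * (1 - v))) * (t * q ^ i)"
      unfolding c_def d1 tt psuc qM' using that by (simp add: A_def B_def C_def u_def v_def)
    have c2: "c M (Suc i) = A / (B * (1 - u) * C) * (t * q ^ i)"
      unfolding c_def d1 tt psuc using \<open>i < M\<close> by (simp add: A_def B_def C_def u_def)
    have c3: "c M i = A / (B * (C * (1 - v))) * t"
      unfolding c_def d1 psuc using \<open>i < M\<close> by (simp add: A_def B_def C_def v_def t_def)
    have qM2: "q ^ M = q ^ i * v" using qM by (simp add: v_def)
    show ?thesis unfolding c1 c2 c3 qM2 using nzz by (simp add: divide_simps) algebra
  qed
  have c0: "c (Suc M) 0 = 1" "c M 0 = 1" using nz p0 by (auto simp: c_def)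
  have "(\<Prod>k<Suc M. 1 + y * q ^ k) = (\<Sum>j\<le>M. c M j * y ^ j) * (1 + y * q ^ M)"
    using Suc by (simp add: c_def)
  also have "\<dots> = (\<Sum>j\<le>M. c M j * y ^ j) + (\<Sum>j\<le>M. q ^ M * c M j * y ^ Suc j)"
    by (simp add: algebra_simps sum_distrib_left sum.distrib)
  also have "(\<Sum>j\<le>M. c M j * y ^ j) = (\<Sum>j\<le>Suc M. c M j * y ^ j)"
    by (simp add: c_def)
  also have "(\<Sum>j\<le>Suc M. c M j * y ^ j) = 1 + (\<Sum>j\<le>M. c M (Suc j) * y ^ Suc j)"
    by (subst sum.atMost_Suc_shift) (simp add: c0)
  also have "1 + (\<Sum>j\<le>M. c M (Suc j) * y ^ Suc j) + (\<Sum>j\<le>M. q ^ M * c M j * y ^ Suc j) =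
             1 + (\<Sum>j\<le>M. c (Suc M) (Suc j) * y ^ Suc j)"
    by (simp add: step sum.distrib algebra_simps)
  also have "\<dots> = (\<Sum>j\<le>Suc M. c (Suc M) j * y ^ j)"
    by (subst sum.atMost_Suc_shift) (simp add: c0)
  finally show ?case by (simp add: c_def)
qed

text \<open>For \<open>n \<ge> 0\<close> the term is \<open>(r * t ^ n) ^ n\<close>, eventually
  below \<open>(1/2) ^ n\<close>; negative indices reduce to this with \<open>inverse r\<close> for
  \<open>r\<close>.\<close>

lemma theta_summable_real:
  fixes r t :: real
  assumes "r > 0" "0 < t" "t < 1"
  shows "(\<lambda>n::int. r powi n * t powi (n * n)) summable_on UNIV"
proof -
  have *: "(\<lambda>n::nat. r powi int n * t powi (int n * int n)) summable_on UNIV" if r: "r > 0" for r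
  proof -
    have "summable (\<lambda>n. r ^ n * t ^ (n * n))"
    proof -
      have "(\<lambda>n. r * t ^ n) \<longlonglongrightarrow> r * 0"
        using assms by (intro tendsto_intros LIMSEQ_power_zero) auto
      hence "eventually (\<lambda>n. r * t ^ n < 1/2) sequentially"
        by (intro order_tendstoD) auto
      hence "eventually (\<lambda>n. norm (r ^ n * t ^ (n * n)) \<le> (1/2) ^ n) sequentially"
      proof eventually_elim
        case (elim n)
        have "(r * t ^ n) ^ n \<le> (1/2) ^ n"
          using elim r assms by (intro power_mono) auto
        thus ?case using r assms by (simp add: power_mult_distrib power_mult abs_mult)
      qed
      thus ?thesis by (rule summable_comparison_test_ev) (auto intro: summable_geometric)
    qed
    hence "(\<lambda>n. r ^ n * t ^ (n * n)) summable_on UNIV"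
      using r assms by (intro summable_nonneg_imp_summable_on) auto
    thus ?thesis by (simp flip: of_nat_mult)
  qed
  let ?f = "\<lambda>n::int. r powi n * t powi (n * n)"
  have 1: "?f summable_on range int"
    using *[OF assms(1)] by (subst summable_on_reindex) (auto simp: o_def)
  have 2: "?f summable_on range (\<lambda>n. - int n)"
    using *[of "inverse r"] assms(1)
    by (subst summable_on_reindex) (auto simp: o_def inj_on_def power_int_minus power_inverse)
  have "?f summable_on (range int \<union> range (\<lambda>n. - int n))"
    by (rule summable_on_union[OF 1 2])
  also have "range int \<union> range (\<lambda>n. - int n) = UNIV"
    by (metis (no_types, lifting) UNIV_eq_I UnI1 UnI2 int_cases2 rangeI)
  finally show ?thesis .
qed

lemma theta_abs_summable:
  fixes x s :: complex
  assumes "x \<noteq> 0" "0 < norm s" "norm s < 1"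
  shows "(\<lambda>n::int. norm (x powi n * s powi (n * n))) summable_on UNIV"
  using theta_summable_real[of "norm x" "norm s"] assms by (simp add: norm_mult norm_power_int)

text \<open>Dominated convergence for two-sided series: the enumeration \<open>int_decode\<close> of
  the integers reduces it to Tannery's theorem.\<close>

lemma dominated_infsum_int:
  fixes a :: "nat \<Rightarrow> int \<Rightarrow> complex"
  assumes lim: "\<And>n. (\<lambda>N. a N n) \<longlonglongrightarrow> b n"
    and bound: "\<And>N n. norm (a N n) \<le> M n" and M: "M summable_on UNIV"
  shows "(\<lambda>N. infsum (a N) UNIV) \<longlonglongrightarrow> infsum b UNIV"
proof -
  have bij: "bij int_decode" by (rule bij_int_decode)
  have sm: "summable (\<lambda>k. M (int_decode k))"
  proof -
    have "(\<lambda>k. M (int_decode k)) summable_on UNIV"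
      using M summable_on_reindex_bij_betw[OF bij, of M] by simp
    thus ?thesis by (rule summable_on_imp_summable)
  qed
  have tr: "infsum f UNIV = (\<Sum>k. f (int_decode k))" if "\<And>n. norm (f n) \<le> M n" for f :: "int \<Rightarrow> complex"
  proof -
    have "summable (\<lambda>k. norm (f (int_decode k)))"
      by (rule summable_comparison_test'[OF sm, of 0]) (use that in auto)
    hence "((\<lambda>k. f (int_decode k)) has_sum (\<Sum>k. f (int_decode k))) UNIV"
      by (intro norm_summable_imp_has_sum summable_sums[OF summable_norm_cancel])
    from infsumI[OF this] show ?thesis by (simp add: infsum_reindex_bij_betw[OF bij])
  qed
  have bb: "norm (b n) \<le> M n" for n
    by (rule tendsto_upperbound[OF tendsto_norm[OF lim]]) (use bound in \<open>auto intro: always_eventually\<close>)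
  have ev: "eventually (\<lambda>(k, N). norm (a N (int_decode k)) \<le> M (int_decode k)) (at_top \<times>\<^sub>F sequentially)"
    using bound by (intro always_eventually) auto
  have "(\<lambda>N. \<Sum>k. a N (int_decode k)) \<longlonglongrightarrow> (\<Sum>k. b (int_decode k))"
    using tannerys_theorem[of "\<lambda>k N. a N (int_decode k)" "\<lambda>k. b (int_decode k)" sequentially "\<lambda>k. M (int_decode k)"]
      lim ev sm by simp
  thus ?thesis using tr[OF bound] tr[OF bb] by simp
qed

text \<open>The first \<open>N\<close> odd numbers add up to \<open>N * N\<close>.\<close>

lemma prod_odd_powi:
  fixes s :: complex
  assumes "s \<noteq> 0"
  shows "(\<Prod>k<N. s powi (- 1 - 2 * int k)) = s powi (- (int N * int N))"
proof (induction N)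
  case (Suc N)
  have "s powi (- (int (Suc N) * int (Suc N))) = s powi (- (int N * int N) + (- 1 - 2 * int N))"
    by (rule arg_cong[of _ _ "power_int s"]) (simp add: algebra_simps)
  also have "\<dots> = s powi (- (int N * int N)) * s powi (- 1 - 2 * int N)"
    using assms by (intro power_int_add) auto
  finally show ?case by (simp only: prod.lessThan_Suc Suc.IH)
qed auto

text \<open>The q-binomial theorem with \<open>2 * N\<close> factors, recentred at the middle index
  by \<open>j = N + n\<close>.\<close>

lemma finite_jacobi_triple:
  fixes x s :: complex
  defines "p \<equiv> \<lambda>n. \<Prod>k<n. 1 - (s\<^sup>2) ^ Suc k"
  assumes nz: "\<And>n. p n \<noteq> 0" and x: "x \<noteq> 0" and s: "s \<noteq> 0"
  shows "(\<Prod>k<N. 1 + x * s * (s\<^sup>2) ^ k) * (\<Prod>k<N. 1 + s / x * (s\<^sup>2) ^ k) =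
    (\<Sum>n\<in>{-int N..int N}. p (2 * N) / (p (nat (int N + n)) * p (nat (int N - n))) * (x powi n * s powi (n * n)))"
proof -
  define q where "q = s\<^sup>2"
  \<comment> \<open>With this \<open>y\<close> the factors \<open>1 + y * q ^ k\<close> contain
    \<open>x\<close> times the odd powers of \<open>s\<close> from \<open>1 - 2 * N\<close> to
    \<open>2 * N - 1\<close>, symmetric about exponent 0.\<close>
  define y where "y = x * s powi (1 - 2 * int N)"
  \<comment> \<open>The product of the monomials \<open>x * s powi (- 1 - 2 * k)\<close> that are
    pulled out of the factors with negative exponent.\<close>
  define A where "A = x ^ N * s powi (- (int N * int N))"
  have A: "A \<noteq> 0" using x s by (simp add: A_def)
  have qk: "q ^ k = s powi (2 * int k)" for k
    by (simp add: q_def power_int_mult)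
  have sadd: "s powi (m + n) = s powi m * s powi n" for m n using s by (simp add: power_int_add)
  have split: "(\<Prod>k<N + M. g k) = (\<Prod>k<N. g k) * (\<Prod>k<M. g (N + k))" for M and g :: "nat \<Rightarrow> complex"
    by (induction M) (simp_all add: mult.assoc)
  have "(\<Prod>k<2*N. 1 + y * q ^ k) = (\<Prod>k<N. 1 + y * q ^ k) * (\<Prod>k<N. 1 + y * q ^ (N + k))"
    unfolding mult_2 by (rule split)
  also have "(\<Prod>k<N. 1 + y * q ^ (N + k)) = (\<Prod>k<N. 1 + x * s * q ^ k)"
  proof (rule prod.cong)
    fix k
    have "y * q ^ (N + k) = x * (s powi (1 - 2 * int N) * s powi (2 * int (N + k)))"
      unfolding qk y_def by simp
    also have "\<dots> = x * s powi (1 + 2 * int k)" by (simp flip: sadd)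
    also have "\<dots> = x * s * q ^ k" unfolding sadd qk by simp
    finally show "1 + y * q ^ (N + k) = 1 + x * s * q ^ k" by simp
  qed auto
  \<comment> \<open>Reversing the lower half puts its exponents in the order -1, -3, and so on, and
    each factor then yields one of the form \<open>1 + s / x * q ^ k\<close>.\<close>
  also have "(\<Prod>k<N. 1 + y * q ^ k) = (\<Prod>k<N. 1 + y * q ^ (N - Suc k))"
    by (rule prod.nat_diff_reindex[symmetric])
  also have "\<dots> = (\<Prod>k<N. x * s powi (- 1 - 2 * int k) * (1 + s / x * q ^ k))"
  proof (rule prod.cong)
    fix k assume "k \<in> {..<N}"
    hence k: "int (N - Suc k) = int N - 1 - int k" by auto
    have "y * q ^ (N - Suc k) = x * (s powi (1 - 2 * int N) * s powi (2 * (int N - 1 - int k)))"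
      unfolding qk y_def k by simp
    also have "\<dots> = x * s powi (- 1 - 2 * int k)" by (simp add: algebra_simps flip: sadd)
    finally have 1: "y * q ^ (N - Suc k) = x * s powi (- 1 - 2 * int k)" .
    have "s powi (- 1 - 2 * int k) * (s * q ^ k) = s powi ((- 1 - 2 * int k) + (1 + 2 * int k))"
      unfolding sadd qk by simp
    hence "s powi (- 1 - 2 * int k) * (s * q ^ k) = 1" by simp
    thus "1 + y * q ^ (N - Suc k) = x * s powi (- 1 - 2 * int k) * (1 + s / x * q ^ k)"
      unfolding 1 using x by (simp add: algebra_simps)
  qed auto
  also have "\<dots> = A * (\<Prod>k<N. 1 + s / x * q ^ k)"
    by (simp add: prod.distrib prod_odd_powi s A_def)
  finally have L: "(\<Prod>k<2*N. 1 + y * q ^ k) = A * ((\<Prod>k<N. 1 + x * s * q ^ k) * (\<Prod>k<N. 1 + s / x * q ^ k))"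
    by (simp add: mult_ac)
  have "(\<Prod>k<2*N. 1 + y * q ^ k) = (\<Sum>j\<le>2*N. p (2*N) / (p j * p (2*N - j)) * q ^ (j * (j - 1) div 2) * y ^ j)"
    unfolding p_def q_def using nz unfolding p_def by (rule q_binomial_theorem)
  also have "\<dots> = (\<Sum>n\<in>{-int N..int N}. A * (p (2 * N) / (p (nat (int N + n)) * p (nat (int N - n))) * (x powi n * s powi (n * n))))"
  proof (rule sum.reindex_bij_witness[of _ "\<lambda>n. nat (int N + n)" "\<lambda>j. int j - int N"], goal_cases)
    case (5 j)
    define n where "n = int j - int N"
    have n: "int j = int N + n" by (simp add: n_def)
    have j: "nat (int N + n) = j" "nat (int N - n) = 2 * N - j" using 5 by (auto simp: n_def)
    have "even (j * (j - 1))" by auto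
    hence "2 * (j * (j - 1) div 2) = j * (j - 1)" by simp
    hence "2 * int (j * (j - 1) div 2) = int (j * (j - 1))" by (metis of_nat_mult of_nat_numeral)
    also have "\<dots> = int j * (int j - 1)" by (cases j) (auto simp: algebra_simps)
    finally have e: "2 * int (j * (j - 1) div 2) = int j * (int j - 1)" .
    have "y ^ j = x powi (int N + n) * s powi ((1 - 2 * int N) * int j)"
      by (simp add: y_def power_mult_distrib power_int_mult flip: n)
    also have "x powi (int N + n) = x ^ N * x powi n" using x by (simp add: power_int_add)
    finally have "q ^ (j * (j - 1) div 2) * y ^ j = x ^ N * x powi n * (s powi (int j * (int j - 1)) * s powi ((1 - 2 * int N) * int j))"
      unfolding qk e by simp
    \<comment> \<open>Completing the square:
      \<open>j * (j - 1) + (1 - 2 * N) * j = (j - N)^2 - N^2\<close>.\<close>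
    also have "s powi (int j * (int j - 1)) * s powi ((1 - 2 * int N) * int j) = s powi (- (int N * int N) + n * n)"
      unfolding n by (simp add: algebra_simps flip: sadd)
    finally have "q ^ (j * (j - 1) div 2) * y ^ j = A * (x powi n * s powi (n * n))"
      unfolding sadd A_def by (simp add: mult_ac)
    thus ?case unfolding n_def[symmetric] j by simp
  qed auto
  finally show ?thesis
    unfolding L q_def[symmetric] sum_distrib_left[symmetric]
    by (rule mult_left_cancel[OF A, THEN iffD1])
qed

lemma qpoch_finite_nonzero:
  assumes "norm q < 1" shows "(\<Prod>k<n. 1 - q ^ Suc k :: complex) \<noteq> 0"
proof -
  have "euler_E q \<noteq> 0" by (rule euler_E_nonzero[OF assms])
  hence "q * q ^ k \<noteq> 1" for k
    using qpoch_eq_0_iff[OF assms, of q] by (auto simp: euler_E_eq_qpoch)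
  thus ?thesis by simp
qed

text \<open>The limit of the finite identity: each Gaussian binomial coefficient tends to
  \<open>1 / E\<close>, and dominated convergence exchanges limit and sum.\<close>

theorem jacobi_triple:
  fixes x s :: complex
  assumes x: "x \<noteq> 0" and s: "0 < norm s" "norm s < 1"
  shows "(\<Sum>\<^sub>\<infinity>n::int. x powi n * s powi (n * n)) =
           euler_E (s\<^sup>2) * (qpoch (- (x * s)) (s\<^sup>2) * qpoch (- (s / x)) (s\<^sup>2))"
proof -
  have q: "norm (s\<^sup>2) < 1" using s by (simp add: norm_power power_less_one_iff)
  have s0: "s \<noteq> 0" using s by auto
  define p where "p = (\<lambda>n. \<Prod>k<n. 1 - (s\<^sup>2) ^ Suc k)"
  define E where "E = euler_E (s\<^sup>2)"
  have E0: "E \<noteq> 0" using euler_E_nonzero[OF q] by (simp add: E_def)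
  have pnz: "p n \<noteq> 0" for n unfolding p_def by (rule qpoch_finite_nonzero[OF q])
  have plim: "p \<longlonglongrightarrow> E"
    using qpoch_lim[OF q, of "s\<^sup>2"] by (simp add: p_def E_def euler_E_eq_qpoch)
  \<comment> \<open>As \<open>p\<close> tends to the nonzero limit \<open>E\<close>, both
    \<open>p\<close> and its inverse are bounded, which gives a majorant independent of
    \<open>N\<close>.\<close>
  obtain K where K: "norm (p n) \<le> K" for n
    using convergent_imp_Bseq[OF convergentI[OF plim]] by (auto simp: Bseq_def)
  obtain L where L: "norm (inverse (p n)) \<le> L" for n
    using convergent_imp_Bseq[OF convergentI[OF tendsto_inverse[OF plim E0]]] by (auto simp: Bseq_def)
  have KL: "K \<ge> 0" "L \<ge> 0" using K[of 0] L[of 0] norm_ge_zero order_trans by blast+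
  define t where "t = (\<lambda>n::int. x powi n * s powi (n * n))"
  \<comment> \<open>Zero outside \<open>{-N..N}\<close>, so that every finite sum becomes a sum over
    all integers.\<close>
  define c where "c = (\<lambda>N n. if n \<in> {-int N..int N} then p (2 * N) / (p (nat (int N + n)) * p (nat (int N - n))) else 0)"
  have clim: "(\<lambda>N. c N n * t n) \<longlonglongrightarrow> 1 / E * t n" for n
  proof -
    have f: "filterlim (\<lambda>N. nat (int N + m)) sequentially sequentially" for m
      unfolding filterlim_at_top
    proof
      fix Z show "\<forall>\<^sub>F N in sequentially. Z \<le> nat (int N + m)"
        using eventually_ge_at_top[of "Z + nat (- m)"] by eventually_elim auto
    qed
    have f2: "filterlim (\<lambda>N. 2 * N) sequentially sequentially"
      by (rule filterlim_subseq) (auto simp: strict_mono_def)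
    have "(\<lambda>N. p (2 * N) / (p (nat (int N + n)) * p (nat (int N + (- n))))) \<longlonglongrightarrow> E / (E * E)"
      by (intro tendsto_intros filterlim_compose[OF plim f] filterlim_compose[OF plim f2]) (use E0 in auto)
    moreover have "eventually (\<lambda>N. p (2 * N) / (p (nat (int N + n)) * p (nat (int N + (- n)))) = c N n) sequentially"
      using eventually_ge_at_top[of "nat \<bar>n\<bar>"] by eventually_elim (auto simp: c_def)
    ultimately have "(\<lambda>N. c N n) \<longlonglongrightarrow> E / (E * E)" by (rule Lim_transform_eventually)
    thus ?thesis using E0 by (intro tendsto_intros) auto
  qed
  have cbound: "norm (c N n * t n) \<le> K * L * L * norm (t n)" for N n
  proof -
    have "norm (c N n) \<le> K * (L * L)"
    proof (cases "n \<in> {-int N..int N}")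
      case True
      have "norm (c N n) = norm (p (2 * N)) * (norm (inverse (p (nat (int N + n)))) * norm (inverse (p (nat (int N - n)))))"
        using True by (simp add: c_def norm_mult norm_divide norm_inverse divide_inverse)
      also have "\<dots> \<le> K * (L * L)" by (intro mult_mono K L mult_nonneg_nonneg norm_ge_zero KL)
      finally show ?thesis .
    qed (use KL in \<open>auto simp: c_def\<close>)
    hence "norm (c N n) * norm (t n) \<le> K * (L * L) * norm (t n)" by (rule mult_right_mono) auto
    thus ?thesis by (simp add: norm_mult mult_ac)
  qed
  have tsum: "(\<lambda>n. norm (t n)) summable_on UNIV"
    unfolding t_def by (rule theta_abs_summable) (use x s in auto)
  have "(\<lambda>N. infsum (\<lambda>n. c N n * t n) UNIV) \<longlonglongrightarrow> infsum (\<lambda>n. 1 / E * t n) UNIV"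
    by (rule dominated_infsum_int[OF clim cbound]) (intro summable_on_cmult_right tsum)
  moreover have "infsum (\<lambda>n. c N n * t n) UNIV = (\<Prod>k<N. 1 + x * s * (s\<^sup>2) ^ k) * (\<Prod>k<N. 1 + s / x * (s\<^sup>2) ^ k)" for N
  proof -
    have "infsum (\<lambda>n. c N n * t n) UNIV = infsum (\<lambda>n. c N n * t n) {-int N..int N}"
      by (rule infsum_cong_neutral) (auto simp: c_def)
    also have "\<dots> = (\<Sum>n\<in>{-int N..int N}. c N n * t n)" by simp
    also have "\<dots> = (\<Sum>n\<in>{-int N..int N}. p (2 * N) / (p (nat (int N + n)) * p (nat (int N - n))) * (x powi n * s powi (n * n)))"
      by (rule sum.cong) (auto simp: c_def t_def)
    also have "\<dots> = (\<Prod>k<N. 1 + x * s * (s\<^sup>2) ^ k) * (\<Prod>k<N. 1 + s / x * (s\<^sup>2) ^ k)"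
      unfolding p_def by (rule finite_jacobi_triple[symmetric]) (use pnz x s0 in \<open>auto simp: p_def\<close>)
    finally show ?thesis .
  qed
  moreover have "(\<lambda>N. (\<Prod>k<N. 1 + x * s * (s\<^sup>2) ^ k) * (\<Prod>k<N. 1 + s / x * (s\<^sup>2) ^ k)) \<longlonglongrightarrow>
      qpoch (- (x * s)) (s\<^sup>2) * qpoch (- (s / x)) (s\<^sup>2)"
    using tendsto_mult[OF qpoch_lim[OF q, of "- (x * s)"] qpoch_lim[OF q, of "- (s / x)"]] by simp
  ultimately have "infsum (\<lambda>n. 1 / E * t n) UNIV = qpoch (- (x * s)) (s\<^sup>2) * qpoch (- (s / x)) (s\<^sup>2)"
    using LIMSEQ_unique by auto
  moreover have "infsum (\<lambda>n. 1 / E * t n) UNIV = 1 / E * infsum t UNIV"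
    by (rule infsum_cmult_right')
  ultimately show ?thesis using E0 by (simp add: t_def E_def field_simps)
qed

section \<open>Zeros and quasi-periodicity of the theta product\<close>

text \<open>The theta product of the overview. Its first factor vanishes at the powers of
  \<open>q\<close> with exponent at most 0, its second at those with positive exponent.\<close>

definition qtheta :: "complex \<Rightarrow> complex \<Rightarrow> complex" where
  "qtheta z q = qpoch z q * qpoch (q / z) q"

text \<open>This isolates the zero at \<open>z = 1\<close>; the cofactor there is
  \<open>euler_E q ^ 2\<close>.\<close>

lemma qtheta_factor:
  assumes "norm q < 1"
  shows "qtheta z q = (1 - z) * (qpoch (z * q) q * qpoch (q / z) q)"
  unfolding qtheta_def by (subst (1) qpoch_rec[OF assms]) simp

lemma qtheta_holomorphic:
  assumes "norm q < 1"
  shows "(\<lambda>z. qtheta z q) holomorphic_on - {0}"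
  unfolding qtheta_def using assms by (intro holomorphic_intros) auto

lemma qtheta_eq_0_iff:
  assumes q: "0 < norm q" "norm q < 1" and z: "z \<noteq> 0"
  shows "qtheta z q = 0 \<longleftrightarrow> (\<exists>m::int. z = q powi m)"
proof
  have q0: "q \<noteq> 0" using q by auto
  assume "qtheta z q = 0"
  then consider n where "z * q ^ n = 1" | n where "q / z * q ^ n = 1"
    using q by (auto simp: qtheta_def qpoch_eq_0_iff)
  thus "\<exists>m::int. z = q powi m"
  proof cases
    case 1
    hence "z = q powi (- int n)" using q0 by (simp add: power_int_minus field_simps)
    thus ?thesis ..
  next
    case 2
    hence "z = q powi (int (Suc n))" using q0 z unfolding power_int_of_nat by (simp add: field_simps)
    thus ?thesis ..
  qed
next
  have q0: "q \<noteq> 0" using q by auto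
  assume "\<exists>m::int. z = q powi m"
  then obtain m :: int where m: "z = q powi m" ..
  show "qtheta z q = 0"
  proof (cases "m \<le> 0")
    case True
    hence "z * q ^ nat (- m) = q powi m * q powi (- m)" unfolding m by (simp flip: power_int_of_nat)
    also have "\<dots> = 1" using q0 by (simp flip: power_int_add)
    finally show ?thesis using q by (auto simp: qtheta_def qpoch_eq_0_iff)
  next
    case False
    hence "q * q ^ nat (m - 1) = q powi 1 * q powi (m - 1)" by (simp flip: power_int_of_nat)
    also have "\<dots> = z" using q0 power_int_add[of q 1 "m - 1"] unfolding m by simp
    finally have "q / z * q ^ nat (m - 1) = 1" using z by simp
    thus ?thesis using q by (auto simp: qtheta_def qpoch_eq_0_iff)
  qed
qed

text \<open>The first product loses the factor \<open>1 - z\<close> and the second gains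
  \<open>1 - 1 / z = - (1 - z) / z\<close>.\<close>

lemma qtheta_shift:
  assumes q: "0 < norm q" "norm q < 1" and z: "z \<noteq> 0"
  shows "qtheta (q * z) q = - qtheta z q / z"
proof -
  have q0: "q \<noteq> 0" using q by auto
  have "qtheta (q * z) q = qpoch (z * q) q * qpoch (1 / z) q"
    using q0 by (simp add: qtheta_def mult.commute)
  also have "qpoch (1 / z) q = (1 - 1 / z) * qpoch (q / z) q"
    by (subst qpoch_rec[OF q(2)]) simp
  finally show ?thesis using z by (simp add: qtheta_factor[OF q(2), of z] field_simps)
qed

text \<open>The iterated shift, by induction in both directions. A square root \<open>s\<close> of
  the nome turns the exponent \<open>m * (m - 1) / 2\<close> into an integral one without
  division.\<close>

lemma qtheta_shift_int:
  assumes s: "0 < norm s" "norm s < 1" and z: "z \<noteq> 0"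
  shows "qtheta ((s\<^sup>2) powi m * z) (s\<^sup>2) = (- 1) powi m * s powi (- (m * (m - 1))) * z powi (- m) * qtheta z (s\<^sup>2)"
    (is "?L m = ?R m")
proof -
  have s0: "s \<noteq> 0" using s by auto
  define q where "q = s\<^sup>2"
  have q: "0 < norm q" "norm q < 1" using s by (auto simp: q_def norm_power power_less_one_iff)
  have q0: "q \<noteq> 0" using q by auto
  have Lstep: "?L (m + 1) = - ?L m / (q powi m * z)" for m
  proof -
    have "q powi (m + 1) * z = q * (q powi m * z)" using q0 by (simp add: power_int_add)
    thus ?thesis using qtheta_shift[OF q, of "q powi m * z"] z q0 by (simp add: q_def mult.assoc)
  qed
  have Rstep: "?R (m + 1) = - ?R m / (q powi m * z)" for m
  proof -
    have "s powi (- ((m + 1) * (m + 1 - 1))) = s powi (- (m * (m - 1)) - 2 * m)"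
      by (rule arg_cong[of _ _ "power_int s"]) (simp add: algebra_simps)
    also have "\<dots> = s powi (- (m * (m - 1))) / q powi m"
      using s0 by (subst power_int_diff) (auto simp: q_def power_int_mult)
    finally have 1: "s powi (- ((m + 1) * (m + 1 - 1))) = s powi (- (m * (m - 1))) / q powi m" .
    have 2: "z powi (- (m + 1)) = z powi (- m) / z"
      using z power_int_diff[of z "- m" 1] by simp
    have 3: "(- 1 :: complex) powi (m + 1) = - ((- 1) powi m)"
      by (simp add: power_int_add)
    show ?thesis unfolding 1 2 3 using z q0 by (simp add: field_simps)
  qed
  show ?thesis
  proof (induction m rule: int_induct[where k = 0])
    case base show ?case by simp
  next
    case (step1 i) thus ?case unfolding Lstep Rstep by simp
  next
    case (step2 i)
    have "- ?L (i - 1) / (q powi (i - 1) * z) = - ?R (i - 1) / (q powi (i - 1) * z)"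
      using step2 Lstep[of "i - 1"] Rstep[of "i - 1"] by simp
    thus ?case using z q0 by simp
  qed
qed

text \<open>The zero at 1 is simple by \<open>qtheta_factor\<close>, and quasi-periodicity carries
  this to every \<open>q powi m\<close>.\<close>

lemma qtheta_deriv_nonzero:
  assumes q: "0 < norm q" "norm q < 1" and z: "z \<noteq> 0" and zero: "qtheta z q = 0"
  shows "deriv (\<lambda>z. qtheta z q) z \<noteq> 0"
proof -
  define s where "s = csqrt q"
  have qs: "q = s\<^sup>2" by (simp add: s_def)
  have s: "0 < norm s" "norm s < 1" using q by (auto simp: qs norm_power power_less_one_iff)
  have q0: "q \<noteq> 0" and s0: "s \<noteq> 0" using q s by auto
  obtain m :: int where m: "z = q powi m" using zero qtheta_eq_0_iff[OF q z] by blast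
  define R where "R = (\<lambda>z. qpoch (z * q) q * qpoch (q / z) q)"
  have R1: "R 1 \<noteq> 0" using euler_E_nonzero[OF q(2)] by (simp add: R_def euler_E_eq_qpoch)
  define c where "c = (- 1) powi m * s powi (- (m * (m - 1)))"
  define G where "G = (\<lambda>w. c * w powi (- m) * R w)"
  have c0: "c \<noteq> 0" using s0 by (simp add: c_def)
  have eq: "qtheta w q = (1 - w / z) * G (w / z)" if "w \<noteq> 0" for w
  proof -
    have "qtheta w q = qtheta (q powi m * (w / z)) q" using q0 by (simp add: m)
    also have "\<dots> = c * (w / z) powi (- m) * qtheta (w / z) q"
      unfolding c_def qs using z that by (intro qtheta_shift_int s) auto
    also have "qtheta (w / z) q = (1 - w / z) * R (w / z)" unfolding R_def by (rule qtheta_factor[OF q(2)])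
    finally show ?thesis by (simp add: G_def)
  qed
  have "G holomorphic_on - {0}"
    unfolding G_def R_def using q by (intro holomorphic_intros) auto
  hence "(\<lambda>w. G (w / z)) holomorphic_on - {0}"
    by (rule holomorphic_on_compose_gen[of "\<lambda>w. w / z", unfolded o_def, rotated]) (use z in \<open>auto intro!: holomorphic_intros\<close>)
  hence "((\<lambda>w. G (w / z)) has_field_derivative deriv (\<lambda>w. G (w / z)) z) (at z)"
    using z by (intro holomorphic_derivI) auto
  \<comment> \<open>Since \<open>1 - w / z\<close> vanishes at \<open>w = z\<close>, only one term
    of the product rule survives.\<close>
  hence "((\<lambda>w. (1 - w / z) * G (w / z)) has_field_derivative (- 1 / z * G 1)) (at z)"
    using z by (auto intro!: derivative_eq_intros)
  hence "((\<lambda>w. qtheta w q) has_field_derivative (- 1 / z * G 1)) (at z)"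
  proof (rule has_field_derivative_transform_within_open)
    show "open (- {0::complex})" by auto
  qed (use eq z in auto)
  hence "deriv (\<lambda>z. qtheta z q) z = - 1 / z * G 1" by (rule DERIV_imp_deriv)
  thus ?thesis using z c0 R1 by (simp add: G_def)
qed

lemma simple_zero_isolated:
  fixes g :: "'a::real_normed_field \<Rightarrow> 'a"
  assumes "(g has_field_derivative g') (at z)" "g' \<noteq> 0" "g z = 0"
  shows "eventually (\<lambda>w. g w \<noteq> 0) (at z)"
proof -
  have "eventually (\<lambda>w. (g w - g z) / (w - z) \<noteq> 0) (at z)"
    using has_field_derivativeD[OF assms(1)] assms(2) by (rule tendsto_imp_eventually_ne)
  thus ?thesis by eventually_elim (use assms(3) in auto)
qed

lemma eventually_qtheta_nonzero:
  assumes q: "0 < norm q" "norm q < 1" and z: "z \<noteq> 0"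
  shows "eventually (\<lambda>w. qtheta w q \<noteq> 0) (at z)"
proof -
  have D: "((\<lambda>w. qtheta w q) has_field_derivative deriv (\<lambda>w. qtheta w q) z) (at z)"
    using qtheta_holomorphic[OF q(2)] z by (intro holomorphic_derivI) auto
  show ?thesis
  proof (cases "qtheta z q = 0")
    case True
    show ?thesis by (rule simple_zero_isolated[OF D qtheta_deriv_nonzero[OF q z True] True])
  next
    case False
    have "((\<lambda>w. qtheta w q) \<longlongrightarrow> qtheta z q) (at z)"
      using DERIV_isCont[OF D] by (simp add: isCont_def)
    thus ?thesis using False by (rule tendsto_imp_eventually_ne)
  qed
qed

section \<open>Holomorphic functions on the punctured plane\<close>

text \<open>At a zero of \<open>g\<close> the quotient receives its value from l'Hopital's rule. It
  is then continuous there, so the isolated singularity is removable.\<close>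

lemma holomorphic_factor_simple_zeros:
  assumes A: "open A" and f: "f holomorphic_on A" and g: "g holomorphic_on A"
    and zeros: "\<And>z. z \<in> A \<Longrightarrow> g z = 0 \<Longrightarrow> f z = 0 \<and> deriv g z \<noteq> 0"
  obtains h where "h holomorphic_on A" "\<And>z. z \<in> A \<Longrightarrow> f z = g z * h z"
proof -
  define h where "h = (\<lambda>z. if g z = 0 then deriv f z / deriv g z else f z / g z)"
  have df: "(f has_field_derivative deriv f z) (at z)" and dg: "(g has_field_derivative deriv g z) (at z)"
    if "z \<in> A" for z using that A f g holomorphic_derivI by blast+
  have h_hol: "h holomorphic_on B" if "B \<subseteq> A" "open B" "\<And>z. z \<in> B \<Longrightarrow> g z \<noteq> 0" for B
  proof -
    have "(\<lambda>z. f z / g z) holomorphic_on B"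
      using that f g by (intro holomorphic_intros) (auto intro: holomorphic_on_subset)
    thus ?thesis by (rule holomorphic_transform) (use that in \<open>auto simp: h_def\<close>)
  qed
  have "h field_differentiable at z" if z: "z \<in> A" for z
  proof (cases "g z = 0")
    case True
    with zeros z have fz: "f z = 0" and gz: "deriv g z \<noteq> 0" by auto
    have ev: "eventually (\<lambda>w. g w \<noteq> 0) (at z)"
      using simple_zero_isolated[OF dg[OF z] gz True] .
    moreover have "eventually (\<lambda>w. w \<in> A) (at z)"
      using z A by (intro eventually_at_in_open') auto
    ultimately have "eventually (\<lambda>w. g w \<noteq> 0 \<and> w \<in> A) (at z)" by eventually_elim auto
    then obtain r where r: "r > 0" "\<And>w. w \<noteq> z \<Longrightarrow> dist w z < r \<Longrightarrow> g w \<noteq> 0 \<and> w \<in> A"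
      by (auto simp: eventually_at)
    have "((\<lambda>w. f w / g w) \<longlongrightarrow> h z) (at z)"
      by (rule lhopital_complex_simple[OF df[OF z] dg[OF z]]) (use fz gz True in \<open>auto simp: h_def\<close>)
    hence lim: "(h \<longlongrightarrow> h z) (at z)"
    proof (rule Lim_transform_eventually)
      show "\<forall>\<^sub>F w in at z. f w / g w = h w" using ev by eventually_elim (auto simp: h_def)
    qed
    have "h holomorphic_on ball z r"
    proof (rule no_isolated_singularity'[of "{z}"])
      show "h holomorphic_on ball z r - {z}"
      proof (rule h_hol)
        have rr: "g w \<noteq> 0 \<and> w \<in> A" if "w \<in> ball z r - {z}" for w
          using r(2)[of w] that by (auto simp: dist_commute)
        show "ball z r - {z} \<subseteq> A" using rr by blast
        show "\<And>w. w \<in> ball z r - {z} \<Longrightarrow> g w \<noteq> 0" using rr by blast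
      qed auto
    qed (use lim in \<open>auto intro: tendsto_within_subset\<close>)
    thus ?thesis using r by (intro holomorphic_on_imp_differentiable_at[of _ "ball z r"]) auto
  next
    case False
    have "open (A \<inter> g -` (- {0}))"
      using A g by (intro continuous_open_preimage holomorphic_on_imp_continuous_on) auto
    hence "h holomorphic_on (A \<inter> g -` (- {0}))" by (intro h_hol) auto
    thus ?thesis using False z \<open>open (A \<inter> g -` (- {0}))\<close>
      by (intro holomorphic_on_imp_differentiable_at[of _ "A \<inter> g -` (- {0})"]) auto
  qed
  hence "h holomorphic_on A" using A by (simp add: holomorphic_on_open field_differentiable_def)
  moreover have "f z = g z * h z" if "z \<in> A" for z
    using zeros that by (auto simp: h_def)
  ultimately show ?thesis by (rule that)
qed

text \<open>Every orbit under \<open>z \<mapsto> p * z\<close> meets a compact annulus, so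
  \<open>H\<close> is bounded and Liouville's theorem applies to the entire function
  \<open>H (exp w)\<close>.\<close>

lemma multiplicatively_periodic_constant:
  fixes H :: "complex \<Rightarrow> complex"
  assumes hol: "H holomorphic_on - {0}" and p: "0 < norm p" "norm p < 1"
    and per: "\<And>z. z \<noteq> 0 \<Longrightarrow> H (p * z) = H z"
  obtains c where "\<And>z. z \<noteq> 0 \<Longrightarrow> H z = c"
proof -
  have p0: "p \<noteq> 0" using p by auto
  have peri: "H (p powi k * z) = H z" if "z \<noteq> 0" for k z
  proof (induction k rule: int_induct[where k = 0])
    case (step1 i)
    have "H (p powi (i + 1) * z) = H (p * (p powi i * z))" using p0 by (simp add: power_int_add mult_ac)
    also have "\<dots> = H z" using step1 per[of "p powi i * z"] that p0 by simp
    finally show ?case .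
  next
    case (step2 i)
    have "H (p powi i * z) = H (p * (p powi (i - 1) * z))"
      using p0 power_int_add[of p 1 "i - 1"] by (simp add: mult.assoc)
    also have "\<dots> = H (p powi (i - 1) * z)" using per[of "p powi (i - 1) * z"] that p0 by simp
    finally show ?case using step2 by simp
  qed auto
  define K where "K = cball (0::complex) 1 - ball 0 (norm p)"
  have "compact K" unfolding K_def by (intro compact_diff) auto
  moreover have "continuous_on K H"
    by (rule continuous_on_subset[OF holomorphic_on_imp_continuous_on[OF hol]]) (use p in \<open>auto simp: K_def\<close>)
  ultimately have "bounded (H ` K)" by (intro compact_imp_bounded compact_continuous_image)
  then obtain B where B: "\<And>z. z \<in> K \<Longrightarrow> norm (H z) \<le> B" by (auto simp: bounded_iff)
  have bd: "norm (H z) \<le> B" if z: "z \<noteq> 0" for z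
  proof -
    \<comment> \<open>The logarithm of \<open>norm z\<close> to base \<open>norm p\<close>. Removing
      its integer part moves \<open>z\<close> into the annulus, because \<open>frac y\<close> lies
      between 0 and 1.\<close>
    define y where "y = ln (norm z) / ln (norm p)"
    have lp: "ln (norm p) < 0" using p by simp
    have zy: "norm z = norm p powr y" using z p lp by (simp add: y_def powr_def)
    have "norm (p powi (- \<lfloor>y\<rfloor>) * z) = norm p powr (- of_int \<lfloor>y\<rfloor>) * norm p powr y"
      using p by (simp add: norm_mult norm_power_int norm_inverse zy powr_real_of_int' power_int_minus powr_minus)
    also have "\<dots> = norm p powr frac y" by (simp add: frac_def flip: powr_add)
    finally have *: "norm (p powi (- \<lfloor>y\<rfloor>) * z) = norm p powr frac y" .
    have "norm p powr 1 \<le> norm p powr frac y" using p by (intro powr_mono') (auto simp: less_imp_le[OF frac_lt_1])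
    moreover have "norm p powr frac y \<le> norm p powr 0" using p by (intro powr_mono') (auto simp: frac_ge_0)
    ultimately have "p powi (- \<lfloor>y\<rfloor>) * z \<in> K" using p by (auto simp: K_def *)
    from B[OF this] show ?thesis using peri[OF z] by simp
  qed
  have "(\<lambda>w. H (exp w)) constant_on UNIV"
  proof (rule Liouville_theorem)
    show "(\<lambda>w. H (exp w)) holomorphic_on UNIV"
      by (rule holomorphic_on_compose_gen[OF holomorphic_on_exp hol, unfolded o_def]) auto
    show "bounded (range (\<lambda>w. H (exp w)))" using bd unfolding bounded_iff by (intro exI[of _ B]) auto
  qed
  then obtain c where "\<And>w. H (exp w) = c" by (auto simp: constant_on_def)
  hence "H z = c" if "z \<noteq> 0" for z using exp_Ln[OF that] by metis
  thus ?thesis by (rule that)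
qed

section \<open>Products over roots of unity\<close>

text \<open>Two polynomials in \<open>w\<close> of degree at most \<open>a\<close> that agree at 0
  and at the \<open>a\<close> roots of unity.\<close>

lemma prod_over_roots_of_unity:
  fixes w :: complex
  assumes "a > 0"
  shows "(\<Prod>z | z ^ a = 1. 1 - w * z) = 1 - w ^ a"
proof -
  let ?U = "{z::complex. z ^ a = 1}"
  have card: "card ?U = a" by (rule card_roots_unity_eq[OF assms])
  have fin: "finite ?U" using card assms card_ge_0_finite by force
  define P where "P = (\<Prod>z\<in>?U. [:1, - z:])"
  define Q where "Q = 1 - monom (1::complex) a"
  have z0: "0 \<notin> ?U" using assms by (simp add: zero_power)
  have "P = Q"
  proof (rule poly_eqI_degree)
    fix w assume "w \<in> insert 0 ?U"
    thus "poly P w = poly Q w"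
    proof (rule insertE)
      assume w: "w \<in> ?U"
      hence "w \<noteq> 0" using z0 by blast
      hence "inverse w \<in> ?U" "w * inverse w = 1" using w by (auto simp: power_inverse)
      hence "\<exists>z\<in>?U. 1 - w * z = 0" by (intro bexI[of _ "inverse w"]) auto
      hence "(\<Prod>z\<in>?U. 1 - w * z) = 0" using fin by (auto simp: prod_zero_iff)
      thus ?thesis using w by (simp add: P_def Q_def poly_prod poly_monom)
    qed (use assms in \<open>simp add: P_def Q_def poly_prod poly_monom\<close>)
  next
    have "degree P \<le> (\<Sum>z\<in>?U. degree [:1, - z:])"
      using degree_prod_sum_le[OF fin, of "\<lambda>z. [:1, - z:]"] by (simp add: P_def o_def)
    also have "\<dots> \<le> (\<Sum>z\<in>?U. 1)" by (intro sum_mono) auto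
    finally show "degree P < card (insert 0 ?U)" using card fin z0 by simp
    have "degree Q \<le> a" unfolding Q_def by (rule degree_diff_le) (auto simp: degree_monom_le)
    thus "degree Q < card (insert 0 ?U)" using card fin z0 by simp
  qed
  hence "poly P w = poly Q w" by simp
  thus ?thesis by (simp add: P_def Q_def poly_prod poly_monom)
qed

section \<open>Powers of the primitive root of unity \<open>omega a\<close>\<close>

lemma omega_nonzero [simp]: "omega a \<noteq> 0" by (simp add: omega_def)

lemma omega_power: "omega a ^ i = cis (2 * pi * real i / real a)"
  by (simp add: omega_def cis_conv_exp flip: exp_of_nat_mult) (simp add: mult_ac)

lemma omega_power_a: "a > 0 \<Longrightarrow> omega a ^ a = 1"
  by (simp add: omega_power)

lemma omega_powi_eq_1_iff:
  assumes "a > 0"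
  shows "omega a powi m = 1 \<longleftrightarrow> int a dvd m"
proof -
  have "omega a powi m = omega a powi (int a * (m div int a)) * omega a powi (m mod int a)"
    by (subst power_int_add[symmetric]) auto
  also have "omega a powi (int a * (m div int a)) = (omega a ^ a) powi (m div int a)"
    by (simp add: power_int_mult)
  also have "(omega a ^ a) powi (m div int a) * omega a powi (m mod int a) = omega a ^ nat (m mod int a)"
    using assms by (simp add: omega_power_a power_int_def)
  also have "\<dots> = 1 \<longleftrightarrow> m mod int a = 0"
  proof -
    let ?k = "nat (m mod int a)"
    have k: "?k < a" using assms by (simp add: nat_less_iff)
    have "omega a ^ ?k = 1 \<longleftrightarrow> omega a ^ ?k = omega a ^ 0" by simp
    also have "\<dots> \<longleftrightarrow> ?k = 0"
      unfolding omega_power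
      using bij_betw_imp_inj_on[OF Complex.bij_betw_roots_unity[OF assms]] k assms by (subst inj_on_eq_iff) auto
    also have "m mod int a \<ge> 0" using assms by simp
    hence "?k = 0 \<longleftrightarrow> m mod int a = 0" by arith
    finally show ?thesis .
  qed
  finally show ?thesis by (simp add: dvd_eq_mod_eq_0)
qed

lemma prod_omega:
  assumes "a > 0" shows "(\<Prod>i<a. 1 - w * omega a ^ i) = 1 - w ^ a"
  using prod.reindex_bij_betw[OF Complex.bij_betw_roots_unity[OF assms], of "\<lambda>z. 1 - w * z"]
    prod_over_roots_of_unity[OF assms, of w] by (simp add: omega_power)

text \<open>Inversion permutes the roots of unity.\<close>

lemma prod_omega_inverse:
  assumes "a > 0" shows "(\<Prod>i<a. 1 - w / omega a ^ i) = 1 - w ^ a"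
proof -
  have "(\<Prod>i<a. 1 - w / omega a ^ i) = (\<Prod>z | z ^ a = 1. 1 - w / z)"
    using prod.reindex_bij_betw[OF Complex.bij_betw_roots_unity[OF assms], of "\<lambda>z. 1 - w / z"]
    by (simp add: omega_power)
  also have "\<dots> = (\<Prod>z | z ^ a = 1. 1 - w * z)"
    by (rule prod.reindex_bij_witness[of _ inverse inverse]) (auto simp: power_inverse divide_inverse)
  finally show ?thesis using prod_over_roots_of_unity[OF assms] by simp
qed

text \<open>The exponents add up to \<open>a * (a - 1) / 2\<close>. Writing
  \<open>omega a = h ^ 2\<close> with \<open>h ^ a = - 1\<close> avoids the halving and a case split
  on parity.\<close>

lemma prod_all_omega:
  assumes "a > 0" shows "(\<Prod>i<a. omega a ^ i) = (- 1) ^ (a - 1)"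
proof -
  define h where "h = cis (pi / real a)"
  have h: "omega a = h ^ 2" using omega_power[of a 1] by (simp add: h_def power2_eq_square cis_mult)
  have ha: "h ^ a = - 1" using assms by (simp add: h_def Complex.DeMoivre)
  have "(\<Prod>i<n. (h ^ 2) ^ i) = h ^ (n * (n - 1))" for n
  proof (induction n)
    case (Suc n)
    have "Suc n * (Suc n - 1) = n * (n - 1) + 2 * n" by (cases n) auto
    thus ?case by (simp only: prod.lessThan_Suc Suc.IH power_add power_mult)
  qed auto
  hence "(\<Prod>i<a. omega a ^ i) = (h ^ a) ^ (a - 1)" by (simp add: h power_mult)
  thus ?thesis by (simp add: ha)
qed

text \<open>The finite and the infinite product are exchanged and \<open>f\<close> is applied factor
  by factor. Both \<open>omega a ^ i\<close> and its inverse will serve as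
  \<open>f i\<close>.\<close>

lemma prod_qpoch:
  assumes q: "norm q < 1" and "a > 0" and f: "\<And>w. (\<Prod>i<a. 1 - w * f i) = 1 - w ^ a"
  shows "(\<Prod>i<a. qpoch (w * f i) q) = qpoch (w ^ a) (q ^ a)"
proof -
  have "(\<Prod>i<a. qpoch (w * f i) q) = (\<Prod>n. \<Prod>i<a. 1 - w * f i * q ^ n)"
    unfolding qpoch_def by (rule prodinf_prod[symmetric]) (rule convergent_prod_qpoch[OF q])
  also have "(\<lambda>n. \<Prod>i<a. 1 - w * f i * q ^ n) = (\<lambda>n. 1 - w ^ a * (q ^ a) ^ n)"
  proof
    fix n
    have "(\<Prod>i<a. 1 - w * f i * q ^ n) = (\<Prod>i<a. 1 - (w * q ^ n) * f i)" by (simp add: mult_ac)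
    also have "\<dots> = 1 - w ^ a * (q ^ a) ^ n" unfolding f by (simp add: power_mult_distrib mult.commute flip: power_mult)
    finally show "(\<Prod>i<a. 1 - w * f i * q ^ n) = 1 - w ^ a * (q ^ a) ^ n" .
  qed
  finally show ?thesis by (simp add: qpoch_def)
qed

section \<open>Lattice sums\<close>

text \<open>Level 0 is the summation range of the theorem; translations of the vectors lead to the
  other levels.\<close>

definition sum_level :: "nat \<Rightarrow> int \<Rightarrow> (nat \<Rightarrow> int) set" where
  "sum_level a m = {n \<in> {..<a} \<rightarrow>\<^sub>E UNIV. (\<Sum>i<a. n i) = m}"

text \<open>
  Here \<open>s\<close> is a square root of \<open>q\<close>, and the weights \<open>x\<close> absorb both \<open>z\<close> and the powers of \<open>\<omega>\<close>,
  which makes every symmetry of the sum a change of \<open>x\<close>.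
\<close>

definition lattice_term :: "nat \<Rightarrow> complex \<Rightarrow> (nat \<Rightarrow> complex) \<Rightarrow> (nat \<Rightarrow> int) \<Rightarrow> complex" where
  "lattice_term a s x n = (\<Prod>i<a. x i powi n i * s powi (n i * n i))"

definition lattice_sum :: "nat \<Rightarrow> complex \<Rightarrow> (nat \<Rightarrow> complex) \<Rightarrow> int \<Rightarrow> complex" where
  "lattice_sum a s x m = (\<Sum>\<^sub>\<infinity>n\<in>sum_level a m. lattice_term a s x n)"

section \<open>Symmetries of the lattice sums\<close>

lemma prod_powi: "finite A \<Longrightarrow> s \<noteq> 0 \<Longrightarrow> (\<Prod>i\<in>A. s powi f i) = s powi (\<Sum>i\<in>A. f i)" for s :: complex
  by (induction A rule: finite_induct) (auto simp: power_int_add)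

lemma lattice_sum_cong: "(\<And>i. i < a \<Longrightarrow> x i = y i) \<Longrightarrow> lattice_sum a s x m = lattice_sum a s y m"
  unfolding lattice_sum_def lattice_term_def by (intro infsum_cong prod.cong) auto

text \<open>Substituting \<open>n + k\<close> for \<open>n\<close>: in
  \<open>(n + k)^2 = k^2 + 2 * k * n + n^2\<close> the first term leaves the sum and the cross term
  joins the weights.\<close>

lemma lattice_sum_translate:
  fixes k :: "nat \<Rightarrow> int"
  assumes s: "s \<noteq> 0" and x: "\<And>i. i < a \<Longrightarrow> x i \<noteq> 0"
  shows "lattice_sum a s x (m + (\<Sum>i<a. k i)) =
           (\<Prod>i<a. x i powi k i * s powi (k i * k i)) * lattice_sum a s (\<lambda>i. x i * s powi (2 * k i)) m"
proof -
  have "lattice_sum a s x (m + (\<Sum>i<a. k i)) =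
     (\<Sum>\<^sub>\<infinity>n\<in>sum_level a m. (\<Prod>i<a. x i powi k i * s powi (k i * k i)) * lattice_term a s (\<lambda>i. x i * s powi (2 * k i)) n)"
    unfolding lattice_sum_def
  proof (rule infsum_reindex_bij_witness[of _ "\<lambda>n. restrict (\<lambda>i. n i + k i) {..<a}" "\<lambda>n. restrict (\<lambda>i. n i - k i) {..<a}"], goal_cases)
    case (5 n)
    show ?case unfolding lattice_term_def prod.distrib[symmetric]
    proof (rule prod.cong, goal_cases)
      case (2 i)
      hence i: "i < a" by simp
      define r where "r = n i - k i"
      have n: "n i = r + k i" by (simp add: r_def)
      have "s powi (n i * n i) = s powi (k i * k i + 2 * k i * r + r * r)"
        unfolding n by (rule arg_cong[of _ _ "power_int s"]) (simp add: algebra_simps)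
      also have "\<dots> = s powi (k i * k i) * (s powi (2 * k i)) powi r * s powi (r * r)"
        using s by (simp add: power_int_add power_int_mult)
      finally have e: "s powi (n i * n i) = s powi (k i * k i) * (s powi (2 * k i)) powi r * s powi (r * r)" .
      have "x i powi n i = x i powi r * x i powi k i" using x[OF i] by (simp add: n power_int_add)
      thus ?case using i e by (simp add: r_def[symmetric] power_int_mult_distrib mult_ac)
    qed auto
  qed (auto simp: sum_level_def fun_eq_iff restrict_def PiE_def extensional_def sum.distrib sum_subtractf)
  also have "\<dots> = (\<Prod>i<a. x i powi k i * s powi (k i * k i)) * lattice_sum a s (\<lambda>i. x i * s powi (2 * k i)) m"
    unfolding lattice_sum_def by (rule infsum_cmult_right')
  finally show ?thesis .
qed

text \<open>The exponents of \<open>c\<close> add up to the coordinate sum, which is constant on a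
  level.\<close>

lemma lattice_sum_scale:
  assumes c: "c \<noteq> 0"
  shows "lattice_sum a s (\<lambda>i. c * x i) m = c powi m * lattice_sum a s x m"
proof -
  have "lattice_sum a s (\<lambda>i. c * x i) m = (\<Sum>\<^sub>\<infinity>n\<in>sum_level a m. c powi m * lattice_term a s x n)"
    unfolding lattice_sum_def
  proof (rule infsum_cong)
    fix n assume "n \<in> sum_level a m"
    hence "c powi m = (\<Prod>i<a. c powi n i)" using c by (simp add: prod_powi sum_level_def)
    thus "lattice_term a s (\<lambda>i. c * x i) n = c powi m * lattice_term a s x n"
      by (simp add: lattice_term_def power_int_mult_distrib mult.assoc flip: prod.distrib)
  qed
  thus ?thesis by (simp add: lattice_sum_def infsum_cmult_right')
qed

text \<open>Levels and sums of squares are symmetric in the coordinates, so a permutation of the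
  weights can be undone on the vectors.\<close>

lemma lattice_sum_permute:
  assumes \<sigma>: "\<sigma> permutes {..<a}"
  shows "lattice_sum a s (\<lambda>i. x (\<sigma> i)) m = lattice_sum a s x m"
  unfolding lattice_sum_def
proof (rule infsum_reindex_bij_witness[of _ "\<lambda>n. n \<circ> \<sigma>" "\<lambda>n. n \<circ> inv \<sigma>"], goal_cases)
  case (1 n) show ?case using permutes_inv_o[OF \<sigma>] by (simp add: o_assoc[symmetric])
next
  case (3 n) show ?case using permutes_inv_o[OF \<sigma>] by (simp add: o_assoc[symmetric])
next
  case (2 n)
  have "(\<Sum>i<a. n (inv \<sigma> i)) = (\<Sum>i<a. n i)"
    using sum.permute[OF permutes_inv[OF \<sigma>], of n] by (simp add: o_def)
  moreover have "inv \<sigma> i = i" if "i \<notin> {..<a}" for i using permutes_inv[OF \<sigma>] that by (auto simp: permutes_def)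
  ultimately show ?case using 2 by (auto simp: sum_level_def PiE_def extensional_def)
next
  case (4 n)
  have "(\<Sum>i<a. n (\<sigma> i)) = (\<Sum>i<a. n i)"
    using sum.permute[OF \<sigma>, of n] by (simp add: o_def)
  moreover have "\<sigma> i = i" if "i \<notin> {..<a}" for i using \<sigma> that by (auto simp: permutes_def)
  ultimately show ?case using 4 by (auto simp: sum_level_def PiE_def extensional_def)
next
  case (5 n)
  show ?case
    unfolding lattice_term_def
    using prod.permute[OF \<sigma>, of "\<lambda>i. x i powi (n \<circ> inv \<sigma>) i * s powi ((n \<circ> inv \<sigma>) i * (n \<circ> inv \<sigma>) i)"]
    by (simp add: o_def permutes_inverses(2)[OF \<sigma>])
qed

text \<open>The term is a product of one-dimensional theta terms, each absolutely summable.\<close>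

lemma lattice_term_abs_summable:
  assumes s: "0 < norm s" "norm s < 1" and x: "\<And>i. i < a \<Longrightarrow> x i \<noteq> 0"
  shows "(\<lambda>n. norm (lattice_term a s x n)) summable_on ({..<a} \<rightarrow>\<^sub>E UNIV)"
  unfolding lattice_term_def
proof (subst abs_summable_equivalent, rule abs_summable_on_prod_PiE)
  fix i assume "i \<in> {..<a}"
  thus "Infinite_Set_Sum.abs_summable_on (\<lambda>k. x i powi k * s powi (k * k)) UNIV"
    by (subst abs_summable_equivalent[symmetric]) (use theta_abs_summable[OF x s] in auto)
qed auto

lemma lattice_summable:
  assumes s: "0 < norm s" "norm s < 1" and x: "\<And>i. i < a \<Longrightarrow> x i \<noteq> 0"
    and "A \<subseteq> {..<a} \<rightarrow>\<^sub>E UNIV"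
  shows "lattice_term a s x summable_on A"
  using lattice_term_abs_summable[of s a x, OF s x] assms(4) abs_summable_summable summable_on_subset_banach by blast

text \<open>The levels partition the whole lattice, over which the absolutely convergent sum factors
  into one-dimensional series.\<close>

lemma lattice_sum_total:
  assumes s: "0 < norm s" "norm s < 1" and x: "\<And>i. i < a \<Longrightarrow> x i \<noteq> 0"
  shows "(\<Sum>\<^sub>\<infinity>m. lattice_sum a s x m) = (\<Prod>i<a. \<Sum>\<^sub>\<infinity>k. x i powi k * s powi (k * k))"
proof -
  let ?S = "SIGMA m:UNIV. sum_level a m"
  have bij: "bij_betw snd ?S ({..<a} \<rightarrow>\<^sub>E UNIV)"
    by (rule bij_betw_byWitness[where f' = "\<lambda>n. (\<Sum>i<a. n i, n)"]) (auto simp: sum_level_def)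
  have "(\<lambda>p. lattice_term a s x (snd p)) summable_on ?S"
    using lattice_summable[OF s x order.refl] by (subst summable_on_reindex_bij_betw[OF bij]) auto
  hence "(\<Sum>\<^sub>\<infinity>m. lattice_sum a s x m) = (\<Sum>\<^sub>\<infinity>p\<in>?S. lattice_term a s x (snd p))"
    using infsum_Sigma_banach[of "\<lambda>p. lattice_term a s x (snd p)" UNIV "sum_level a"] by (simp add: lattice_sum_def)
  also have "\<dots> = infsum (lattice_term a s x) ({..<a} \<rightarrow>\<^sub>E UNIV)"
    by (rule infsum_reindex_bij_betw[OF bij])
  also have "\<dots> = (\<Prod>i<a. \<Sum>\<^sub>\<infinity>k. x i powi k * s powi (k * k))"
    unfolding lattice_term_def by (rule infsum_prod_PiE_abs) (use theta_abs_summable[OF x s] in auto)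
  finally show ?thesis .
qed

text \<open>A cyclic shift of the weights multiplies each of them by \<open>omega a\<close>,
  wrapping around because \<open>omega a ^ a = 1\<close>. The sum thus equals
  \<open>omega a powi m\<close> times itself, and that factor is not 1.\<close>

lemma lattice_sum_omega_eq_0:
  assumes a: "a > 0" and m: "\<not> int a dvd m"
  shows "lattice_sum a s (\<lambda>i. omega a ^ i) m = 0"
proof -
  define \<sigma> where "\<sigma> = (\<lambda>i. if i < a then Suc i mod a else i)"
  have inj: "inj_on \<sigma> {..<a}"
    by (rule inj_onI) (auto simp: \<sigma>_def mod_Suc split: if_splits)
  moreover have "\<sigma> ` {..<a} \<subseteq> {..<a}" using a by (auto simp: \<sigma>_def)
  ultimately have "bij_betw \<sigma> {..<a} {..<a}"
    by (simp add: bij_betw_def endo_inj_surj)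
  hence perm: "\<sigma> permutes {..<a}" by (rule bij_imp_permutes) (auto simp: \<sigma>_def)
  have "omega a ^ \<sigma> i = omega a * omega a ^ i" if "i < a" for i
    using that a omega_power_a[of a] by (auto simp: \<sigma>_def mod_Suc simp flip: power_Suc)
  hence "lattice_sum a s (\<lambda>i. omega a ^ \<sigma> i) m = lattice_sum a s (\<lambda>i. omega a * omega a ^ i) m"
    by (rule lattice_sum_cong)
  hence "lattice_sum a s (\<lambda>i. omega a ^ i) m = omega a powi m * lattice_sum a s (\<lambda>i. omega a ^ i) m"
    using lattice_sum_permute[OF perm, of s "\<lambda>i. omega a ^ i" m] lattice_sum_scale[of "omega a" a s "\<lambda>i. omega a ^ i" m] by simp
  thus ?thesis using m a omega_powi_eq_1_iff[of a m] by auto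
qed

text \<open>Translation by the constant vector \<open>(k, ..., k)\<close> leads to level 0 and
  multiplies all weights by \<open>s powi (2 * k)\<close>, which has no effect at level 0.\<close>

lemma lattice_sum_omega_multiple:
  assumes a: "a > 0" and s: "s \<noteq> 0"
  shows "lattice_sum a s (\<lambda>i. omega a ^ i) (int a * k) =
           ((- 1) ^ (a - 1)) powi k * (s ^ a) powi (k * k) * lattice_sum a s (\<lambda>i. omega a ^ i) 0"
proof -
  have P: "(\<Prod>i\<in>A. f i powi k) = (\<Prod>i\<in>A. f i) powi k" if "finite A" for A :: "nat set" and f :: "nat \<Rightarrow> complex" and k
    using that by (induction A rule: finite_induct) (auto simp: power_int_mult_distrib)
  have "lattice_sum a s (\<lambda>i. omega a ^ i) (int a * k) =
     (\<Prod>i<a. (omega a ^ i) powi k * s powi (k * k)) * lattice_sum a s (\<lambda>i. s powi (2 * k) * omega a ^ i) 0"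
    using lattice_sum_translate[of s a "\<lambda>i. omega a ^ i" 0 "\<lambda>_. k"] s by (simp add: mult.commute)
  also have "lattice_sum a s (\<lambda>i. s powi (2 * k) * omega a ^ i) 0 = lattice_sum a s (\<lambda>i. omega a ^ i) 0"
    using lattice_sum_scale[of "s powi (2 * k)" a s "\<lambda>i. omega a ^ i" 0] s by simp
  also have "(\<Prod>i<a. (omega a ^ i) powi k * s powi (k * k)) = ((- 1) ^ (a - 1)) powi k * (s ^ a) powi (k * k)"
  proof -
    have "(\<Prod>i<a. s powi (k * k)) = (s ^ a) powi (k * k)"
      using P[of "{..<a}" "\<lambda>_. s" "k * k"] by simp
    thus ?thesis
      by (simp only: prod.distrib P[OF finite_lessThan] prod_all_omega[OF a])
  qed
  finally show ?thesis .
qed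

text \<open>The total over all levels is evaluated twice: as a theta series in \<open>s ^ a\<close>
  times the level 0 sum, and as a product of \<open>a\<close> theta series. The triple product turns
  both into multiples of \<open>Q * Q\<close>, which cancels.\<close>

lemma lattice_sum_omega_0:
  assumes a: "a > 0" and s: "0 < norm s" "norm s < 1"
  shows "lattice_sum a s (\<lambda>i. omega a ^ i) 0 * euler_E ((s\<^sup>2) ^ a) = euler_E (s\<^sup>2) ^ a"
proof -
  define q where "q = s\<^sup>2"
  \<comment> \<open>The product of all powers \<open>omega a ^ i\<close>. Being a sign, it is its
    own inverse, so both Pochhammer factors of the series in \<open>s ^ a\<close> coincide with
    \<open>Q\<close>.\<close>
  define \<epsilon> where "\<epsilon> = (- 1 :: complex) ^ (a - 1)"
  have e: "\<epsilon> \<noteq> 0" "s ^ a / \<epsilon> = \<epsilon> * s ^ a" "norm \<epsilon> = 1" "(- s) ^ a = - (\<epsilon> * s ^ a)"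
    using a by (cases a; auto simp: \<epsilon>_def norm_power minus_one_power_iff field_simps power_minus[of s])+
  have s0: "s \<noteq> 0" using s by auto
  have q: "norm q < 1" using s by (simp add: q_def norm_power power_less_one_iff)
  have qa: "norm (q ^ a) < 1" using q a by (simp add: norm_power power_less_one_iff)
  have sa: "0 < norm (s ^ a)" "norm (s ^ a) < 1" using s a by (auto simp: norm_power power_less_one_iff)
  have sq: "(s ^ a)\<^sup>2 = q ^ a" by (simp add: q_def mult.commute flip: power_mult)
  define T where "T = lattice_sum a s (\<lambda>i. omega a ^ i)"
  define Q where "Q = qpoch (- (\<epsilon> * s ^ a)) (q ^ a)"
  have Q0: "Q \<noteq> 0"
  proof
    assume "Q = 0"
    then obtain n where "- (\<epsilon> * s ^ a) * (q ^ a) ^ n = 1" unfolding Q_def qpoch_eq_0_iff[OF qa] by blast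
    hence "norm (- (\<epsilon> * s ^ a) * (q ^ a) ^ n) = 1" by simp
    moreover have "norm (s ^ a) * norm (q ^ a) ^ n < 1 * 1 ^ n"
      using sa qa by (intro mult_less_le_imp_less power_mono) (auto simp: q_def)
    ultimately show False by (simp add: norm_mult norm_power e)
  qed
  have "(\<Sum>\<^sub>\<infinity>m. T m) = (\<Sum>\<^sub>\<infinity>m\<in>range (\<lambda>k. int a * k). T m)"
  proof (rule infsum_cong_neutral)
    fix m assume "m \<in> UNIV - range (\<lambda>k. int a * k)"
    hence "\<not> int a dvd m" by (auto simp: dvd_def)
    thus "T m = 0" unfolding T_def by (rule lattice_sum_omega_eq_0[OF a])
  qed auto
  also have "\<dots> = (\<Sum>\<^sub>\<infinity>k. T (int a * k))"
    using a by (subst infsum_reindex) (auto simp: inj_on_def o_def)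
  also have "\<dots> = (\<Sum>\<^sub>\<infinity>k. (\<epsilon> powi k * (s ^ a) powi (k * k)) * T 0)"
    unfolding T_def \<epsilon>_def lattice_sum_omega_multiple[OF a s0] ..
  also have "\<dots> = (\<Sum>\<^sub>\<infinity>k. \<epsilon> powi k * (s ^ a) powi (k * k)) * T 0"
    by (rule infsum_cmult_left')
  also have "(\<Sum>\<^sub>\<infinity>k. \<epsilon> powi k * (s ^ a) powi (k * k)) = euler_E (q ^ a) * (Q * Q)"
    unfolding jacobi_triple[OF e(1) sa] sq by (simp add: Q_def e)
  finally have 1: "(\<Sum>\<^sub>\<infinity>m. T m) = euler_E (q ^ a) * (Q * Q) * T 0" .
  have "(\<Sum>\<^sub>\<infinity>m. T m) = (\<Prod>i<a. \<Sum>\<^sub>\<infinity>k. (omega a ^ i) powi k * s powi (k * k))"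
    unfolding T_def by (rule lattice_sum_total[OF s]) simp
  also have "\<dots> = (\<Prod>i<a. euler_E q * (qpoch (- s * omega a ^ i) q * qpoch (- s * (1 / omega a ^ i)) q))"
  proof (rule prod.cong)
    fix i
    have "(\<Sum>\<^sub>\<infinity>k. (omega a ^ i) powi k * s powi (k * k)) =
      euler_E (s\<^sup>2) * (qpoch (- (omega a ^ i * s)) (s\<^sup>2) * qpoch (- (s / omega a ^ i)) (s\<^sup>2))"
      by (rule jacobi_triple) (use s in auto)
    thus "(\<Sum>\<^sub>\<infinity>k. (omega a ^ i) powi k * s powi (k * k)) =
      euler_E q * (qpoch (- s * omega a ^ i) q * qpoch (- s * (1 / omega a ^ i)) q)"
      by (simp only: q_def mult_minus_left mult.commute[of s "omega a ^ i"] times_divide_eq_right mult_1_right minus_divide_left)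
  qed auto
  also have "\<dots> = euler_E q ^ a * ((\<Prod>i<a. qpoch (- s * omega a ^ i) q) * (\<Prod>i<a. qpoch (- s * (1 / omega a ^ i)) q))"
    by (simp add: prod.distrib)
  also have "(\<Prod>i<a. qpoch (- s * omega a ^ i) q) = Q"
    unfolding Q_def e(4)[symmetric] by (rule prod_qpoch[OF q a prod_omega[OF a]])
  also have "(\<Prod>i<a. qpoch (- s * (1 / omega a ^ i)) q) = Q"
    unfolding Q_def e(4)[symmetric]
    by (rule prod_qpoch[OF q a]) (use prod_omega_inverse[OF a] in simp)
  finally show ?thesis using 1 Q0 by (simp add: T_def q_def)
qed

text \<open>The factor \<open>z powi n j\<close> of the theorem is encoded as a change of the single
  weight \<open>x j\<close>.\<close>

lemma lattice_term_fun_upd: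
  assumes "j < a"
  shows "lattice_term a s (x(j := z * x j)) n = z powi n j * lattice_term a s x n"
proof -
  have "lattice_term a s (x(j := z * x j)) n = (\<Prod>i<a. (if i = j then z powi n j else 1) * (x i powi n i * s powi (n i * n i)))"
    unfolding lattice_term_def by (rule prod.cong) (auto simp: power_int_mult_distrib mult.assoc)
  also have "\<dots> = (\<Prod>i<a. if i = j then z powi n j else 1) * lattice_term a s x n"
    unfolding lattice_term_def by (rule prod.distrib)
  also have "(\<Prod>i<a. if i = j then z powi n j else 1) = z powi n j"
    using assms by (simp add: prod.delta)
  finally show ?thesis .
qed

text \<open>The Weierstrass M-test on a disc that avoids 0 makes the sum a locally uniform limit of
  holomorphic finite sums.\<close>

lemma lattice_sum_fun_upd_holomorphic:
  assumes s: "0 < norm s" "norm s < 1" and x: "\<And>i. i < a \<Longrightarrow> x i \<noteq> 0" and j: "j < a"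
  shows "(\<lambda>z. lattice_sum a s (x(j := z * x j)) m) holomorphic_on - {0}"
proof (rule holomorphic_onI)
  fix z0 :: complex assume "z0 \<in> - {0}"
  hence z0: "z0 \<noteq> 0" by simp
  define r where "r = norm z0 / 2"
  have r: "r > 0" using z0 by (simp add: r_def)
  \<comment> \<open>The disc lies in \<open>r \<le> norm z \<le> 3 * r\<close>. There
    \<open>norm z powi n j\<close> is at most its value at \<open>3 * r\<close> or at
    \<open>r\<close>, according to the sign of \<open>n j\<close>; the sum of both covers either
    case.\<close>
  define M where "M = (\<lambda>n. norm (lattice_term a s (x(j := of_real r * x j)) n) + norm (lattice_term a s (x(j := of_real (3 * r) * x j)) n))"
  have lv: "sum_level a m \<subseteq> {..<a} \<rightarrow>\<^sub>E UNIV" by (auto simp: sum_level_def)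
  have Msum: "M summable_on sum_level a m"
    unfolding M_def
    by (intro summable_on_add summable_on_subset_banach[OF lattice_term_abs_summable[OF s] lv]) (use x r in \<open>auto split: if_splits\<close>)
  have bound: "norm (lattice_term a s (x(j := z * x j)) n) \<le> M n" if "z \<in> cball z0 r" for z n
  proof -
    have n0: "norm z0 = 2 * r" by (simp add: r_def)
    have "norm z \<le> norm z0 + r" "norm z0 - r \<le> norm z"
      using that norm_triangle_ineq2[of z z0] norm_triangle_ineq2[of z0 z] by (auto simp: dist_norm norm_minus_commute)
    hence z: "r \<le> norm z" "norm z \<le> 3 * r" using n0 by auto
    have "norm z powi n j \<le> r powi n j + (3 * r) powi n j"
    proof (cases "n j \<ge> 0")
      case True
      moreover have "norm z ^ nat (n j) \<le> (3 * r) ^ nat (n j)" using z by (intro power_mono) auto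
      ultimately have "norm z powi n j \<le> (3 * r) powi n j" by (simp add: power_int_def)
      moreover have "r powi n j \<ge> 0" using r by simp
      ultimately show ?thesis by simp
    next
      case False
      hence "norm z powi n j \<le> r powi n j" using z r by (auto simp: power_int_def power_inverse intro!: le_imp_inverse_le power_mono)
      moreover have "(3 * r) powi n j \<ge> 0" using r by simp
      ultimately show ?thesis by simp
    qed
    hence "norm z powi n j * norm (lattice_term a s x n) \<le> (r powi n j + (3 * r) powi n j) * norm (lattice_term a s x n)"
      by (rule mult_right_mono) auto
    thus ?thesis using r unfolding M_def lattice_term_fun_upd[OF j]
      by (simp add: norm_mult norm_power_int distrib_right)
  qed
  have ul: "uniform_limit (cball z0 r) (\<lambda>N z. \<Sum>n\<in>N. lattice_term a s (x(j := z * x j)) n) (\<lambda>z. lattice_sum a s (x(j := z * x j)) m)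
         (finite_subsets_at_top (sum_level a m))"
    unfolding lattice_sum_def using bound Msum by (rule Weierstrass_m_test_general)
  have nz: "0 \<notin> cball z0 r" using r by (simp add: r_def dist_norm)
  have hol: "(\<lambda>z. \<Sum>n\<in>N. lattice_term a s (x(j := z * x j)) n) holomorphic_on cball z0 r" for N
    unfolding lattice_term_fun_upd[OF j] using nz by (intro holomorphic_intros) auto
  have "(\<lambda>z. lattice_sum a s (x(j := z * x j)) m) holomorphic_on ball z0 r"
  proof (rule holomorphic_uniform_limit[OF _ ul])
    show "\<forall>\<^sub>F N in finite_subsets_at_top (sum_level a m).
        continuous_on (cball z0 r) (\<lambda>z. \<Sum>n\<in>N. lattice_term a s (x(j := z * x j)) n) \<and>
        (\<lambda>z. \<Sum>n\<in>N. lattice_term a s (x(j := z * x j)) n) holomorphic_on ball z0 r"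
      by (intro always_eventually allI conjI holomorphic_on_imp_continuous_on[OF hol]
            holomorphic_on_subset[OF hol ball_subset_cball])
  qed simp
  thus "(\<lambda>z. lattice_sum a s (x(j := z * x j)) m) field_differentiable at z0 within - {0}"
    using r by (intro field_differentiable_at_within[OF holomorphic_on_imp_differentiable_at[of _ "ball z0 r"]])
      simp_all
qed

section \<open>The identity\<close>

text \<open>This includes the zeros of the denominator, where both sides are 0 by the convention for
  division by zero.\<close>

lemma product_side_eq:
  assumes q: "0 < norm q" "norm q < 1" and a: "a > 0" and z: "z \<noteq> 0"
  shows "product_side a q z = euler_E q ^ (a - 2) * euler_E (q ^ a) * (qtheta z q / qtheta z (q ^ a))"
proof -
  have qa: "norm (q ^ a) < 1" using q a by (simp add: norm_power power_less_one_iff)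
  define f where "f = (\<lambda>w q n. 1 - w * q ^ n :: complex)"
  have conv: "convergent_prod (f w q)" if "norm q < 1" for w q
    unfolding f_def by (rule convergent_prod_qpoch[OF that])
  have F: "(\<Prod>n. f w q n) = qpoch w q" for w q by (simp add: f_def qpoch_def)
  have "qtheta z q / qtheta z (q ^ a) =
     (\<Prod>n. f z q n * f (q / z) q n) / (\<Prod>n. f z (q ^ a) n * f (q ^ a / z) (q ^ a) n)"
    by (simp add: qtheta_def F q qa conv flip: prodinf_mult)
  also have "\<dots> = (\<Prod>n. (f z q n * f (q / z) q n) / (f z (q ^ a) n * f (q ^ a / z) (q ^ a) n))"
    by (intro prodinf_divide convergent_prod_mult conv q qa)
  also have "(\<lambda>n. (f z q n * f (q / z) q n) / (f z (q ^ a) n * f (q ^ a / z) (q ^ a) n)) =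
     (\<lambda>n. ((1 - z * q ^ n) * (1 - inverse z * q ^ Suc n)) /
            ((1 - z * q ^ (a * n)) * (1 - inverse z * q ^ (a * Suc n))))"
    by (simp add: f_def divide_inverse mult_ac power_add flip: power_mult)
  finally show ?thesis by (simp add: product_side_def)
qed

text \<open>Each \<open>n i * (n i + 1)\<close> is even.\<close>

lemma even_sum_squares:
  fixes n :: "nat \<Rightarrow> int"
  assumes "(\<Sum>i<a. n i) = 0"
  shows "even (\<Sum>i<a. n i * n i)"
proof -
  have "even (\<Sum>i<a. n i * (n i + 1))" by (intro dvd_sum) auto
  thus ?thesis using assms by (simp add: distrib_left sum.distrib)
qed

text \<open>On level 0 the halved exponent is exact, so powers of \<open>s\<^sup>2\<close> may be
  replaced by powers of \<open>s\<close>, which split over the coordinates.\<close>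

lemma theta_term_eq_lattice_term:
  assumes s: "s \<noteq> 0" and n: "n \<in> sum_level a 0" and j: "j < a"
  shows "theta_term a j (s\<^sup>2) z n = lattice_term a s ((\<lambda>i. omega a ^ i)(j := z * omega a ^ j)) n"
proof -
  have n0: "(\<Sum>i<a. n i) = 0" using n by (simp add: sum_level_def)
  have "lattice_term a s ((\<lambda>i. omega a ^ i)(j := z * omega a ^ j)) n = z powi n j * lattice_term a s (\<lambda>i. omega a ^ i) n"
    using lattice_term_fun_upd[OF j, of s "\<lambda>i. omega a ^ i" z n] by simp
  also have "lattice_term a s (\<lambda>i. omega a ^ i) n = (\<Prod>i<a. omega a powi (int i * n i)) * (\<Prod>i<a. s powi (n i * n i))"
    by (simp add: lattice_term_def prod.distrib power_int_mult)
  also have "\<dots> = omega a powi (dot a b_vec n) * s powi (dot a n n)"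
    using s by (simp add: prod_powi dot_def b_vec_def)
  also have "s powi (dot a n n) = (s\<^sup>2) powi (dot a n n div 2)"
  proof -
    have "dot a n n = 2 * (dot a n n div 2)" using even_sum_squares[OF n0] by (simp add: dot_def)
    hence "s powi (dot a n n) = s powi (2 * (dot a n n div 2))" by (rule arg_cong)
    thus ?thesis by (simp only: power_int_mult power_int_numeral)
  qed
  finally show ?thesis by (simp only: theta_term_def mult.assoc)
qed

theorem theorem1p3:
  fixes a j :: nat and q z :: complex
  assumes "a \<ge> 2" and "j \<le> a - 1"
    and "0 < norm q" and "norm q < 1" and "z \<noteq> 0"
  shows "(theta_term a j q z has_sum remove_sings (product_side a q) z) (zero_sum_vecs a)"
proof -
  have a: "a > 0" and j: "j < a" using assms by auto
  note q = assms(3,4)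
  define s where "s = csqrt q"
  have qs: "q = s\<^sup>2" by (simp add: s_def)
  have s: "0 < norm s" "norm s < 1" using q by (auto simp: qs norm_power power_less_one_iff)
  have s0: "s \<noteq> 0" and q0: "q \<noteq> 0" using s q by auto
  have qa: "0 < norm (q ^ a)" "norm (q ^ a) < 1" using q a by (auto simp: norm_power power_less_one_iff)
  define x where "x = (\<lambda>i. omega a ^ i)"
  have x0: "x i \<noteq> 0" for i by (simp add: x_def)
  define T where "T = (\<lambda>z. lattice_sum a s (x(j := z * x j)))"
  define f where "f = (\<lambda>z. T z 0)"
  define \<epsilon> where "\<epsilon> = (- 1 :: complex) ^ (a - 1)"
  have lv: "zero_sum_vecs a = sum_level a 0"
    by (auto simp: zero_sum_vecs_def sum_level_def dot_def ones_vec_def)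
  have f_sum: "(theta_term a j q z has_sum f z) (zero_sum_vecs a)"
  proof -
    have "(lattice_term a s (x(j := z * x j)) has_sum f z) (sum_level a 0)"
      unfolding f_def T_def lattice_sum_def
      by (intro has_sum_infsum lattice_summable s) (use x0 assms(5) in \<open>auto simp: sum_level_def\<close>)
    moreover have "theta_term a j q z n = lattice_term a s (x(j := z * x j)) n" if "n \<in> sum_level a 0" for n
      using theta_term_eq_lattice_term[OF s0 that j] by (simp add: qs x_def)
    ultimately show ?thesis unfolding lv by (simp cong: has_sum_cong)
  qed
  \<comment> \<open>Translation by \<open>r\<close> times the \<open>j\<close>-th unit vector trades
    a change of level for a change of \<open>w\<close>.\<close>
  have T_shift: "T w (m + r) = (w * x j) powi r * s powi (r * r) * T (w * q powi r) m" if w: "w \<noteq> 0" for w m r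
  proof -
    let ?k = "\<lambda>i. if i = j then r else 0"
    have "T w (m + (\<Sum>i<a. ?k i)) = (\<Prod>i<a. (x(j := w * x j)) i powi ?k i * s powi (?k i * ?k i)) *
            lattice_sum a s (\<lambda>i. (x(j := w * x j)) i * s powi (2 * ?k i)) m"
      unfolding T_def by (rule lattice_sum_translate) (use s0 x0 w in auto)
    also have "(\<Sum>i<a. ?k i) = r" using j by (simp add: sum.delta)
    also have "(\<Prod>i<a. (x(j := w * x j)) i powi ?k i * s powi (?k i * ?k i)) = (\<Prod>i<a. if i = j then (w * x j) powi r * s powi (r * r) else 1)"
      by (rule prod.cong) auto
    also have "\<dots> = (w * x j) powi r * s powi (r * r)" using j by (simp add: prod.delta)
    also have "lattice_sum a s (\<lambda>i. (x(j := w * x j)) i * s powi (2 * ?k i)) m = T (w * q powi r) m"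
      unfolding T_def by (rule lattice_sum_cong) (auto simp: qs power_int_mult mult_ac)
    finally show ?thesis .
  qed
  \<comment> \<open>\<open>T 1 m\<close> carries the pure weights \<open>omega a ^ i\<close> and
    vanishes; by \<open>T_shift\<close> it is a nonzero multiple of
    \<open>f (q powi m)\<close>.\<close>
  have f_zero: "f w = 0" if w: "w = q powi m" and m: "\<not> int a dvd m" for w m
  proof -
    have "T 1 m = 0" using lattice_sum_omega_eq_0[OF a m] by (simp add: T_def x_def)
    thus ?thesis using T_shift[of 1 0 m] x0 s0 by (simp add: f_def w)
  qed
  \<comment> \<open>\<open>T w (int a)\<close> is computed twice: translating by \<open>a\<close>
    times the \<open>j\<close>-th unit vector produces \<open>f (q ^ a * w)\<close>, while the
    all-ones vector multiplies every weight by \<open>s powi 2\<close> and gives back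
    \<open>f w\<close>.\<close>
  have f_shift: "f (q ^ a * w) = \<epsilon> * w * s ^ a / (w ^ a * s ^ (a * a)) * f w" if w: "w \<noteq> 0" for w
  proof -
    have xja: "x j ^ a = 1"
    proof -
      have "x j ^ a = (omega a ^ a) ^ j" by (simp only: x_def power_mult[symmetric] mult.commute)
      thus ?thesis by (simp add: omega_power_a[OF a])
    qed
    have "T w (int a) = (w * x j) ^ a * s ^ (a * a) * f (q ^ a * w)"
      using T_shift[OF w, of 0 "int a"] by (simp add: f_def mult.commute flip: of_nat_mult)
    hence 1: "T w (int a) = w ^ a * s ^ (a * a) * f (q ^ a * w)"
      by (simp add: power_mult_distrib xja)
    have "T w (0 + (\<Sum>i<a. 1)) = (\<Prod>i<a. (x(j := w * x j)) i powi 1 * s powi (1 * 1)) *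
            lattice_sum a s (\<lambda>i. (x(j := w * x j)) i * s powi (2 * 1)) 0"
      unfolding T_def by (rule lattice_sum_translate) (use s0 x0 w in auto)
    also have "(\<Prod>i<a. (x(j := w * x j)) i powi 1 * s powi (1 * 1)) = (\<Prod>i<a. (if i = j then w else 1) * x i * s)"
      by (rule prod.cong) auto
    also have "\<dots> = w * \<epsilon> * s ^ a"
      using j prod_all_omega[OF a] by (simp add: prod.distrib prod.delta x_def \<epsilon>_def)
    also have "lattice_sum a s (\<lambda>i. (x(j := w * x j)) i * s powi (2 * 1)) 0 = f w"
      using lattice_sum_scale[of "s powi 2" a s "x(j := w * x j)" 0] s0
      by (simp add: f_def T_def mult.commute)
    finally have "T w (int a) = w * \<epsilon> * s ^ a * f w" by simp
    with 1 show ?thesis using w s0 by (simp add: field_simps)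
  qed
  have f_hol: "f holomorphic_on - {0}"
    unfolding f_def T_def by (rule lattice_sum_fun_upd_holomorphic[OF s x0 j])
  have cont_at: "isCont k v" if "k holomorphic_on - {0}" "v \<noteq> 0" for k :: "complex \<Rightarrow> complex" and v
    using holomorphic_on_imp_differentiable_at[OF that(1)] that(2)
    by (intro field_differentiable_imp_continuous_at) auto
  define F where "F = (\<lambda>w. f w * qtheta w (q ^ a))"
  define g where "g = (\<lambda>w. qtheta w q)"
  have g_hol: "g holomorphic_on - {0}" unfolding g_def by (rule qtheta_holomorphic[OF q(2)])
  have F_hol: "F holomorphic_on - {0}"
    unfolding F_def by (intro holomorphic_on_mult f_hol qtheta_holomorphic[OF qa(2)])
  \<comment> \<open>At a zero \<open>q powi m\<close> of \<open>g\<close>, the factor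
    \<open>qtheta w (q ^ a)\<close> of \<open>F\<close> vanishes if \<open>a\<close> divides
    \<open>m\<close>, and \<open>f\<close> vanishes otherwise.\<close>
  obtain h where h_hol: "h holomorphic_on - {0}" and h: "\<And>w. w \<in> - {0} \<Longrightarrow> F w = g w * h w"
  proof (rule holomorphic_factor_simple_zeros[OF _ F_hol g_hol])
    fix w :: complex assume w: "w \<in> - {0}" and gw: "g w = 0"
    then obtain m :: int where m: "w = q powi m" using qtheta_eq_0_iff[OF q, of w] by (auto simp: g_def)
    have "F w = 0"
    proof (cases "int a dvd m")
      case True
      then obtain k where "m = int a * k" by auto
      hence "w = (q ^ a) powi k" by (simp add: m power_int_mult)
      thus ?thesis using qtheta_eq_0_iff[OF qa, of w] w by (auto simp: F_def)
    qed (use f_zero[OF m] in \<open>simp add: F_def\<close>)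
    moreover have "deriv g w \<noteq> 0" unfolding g_def by (rule qtheta_deriv_nonzero[OF q]) (use w gw in \<open>auto simp: g_def\<close>)
    ultimately show "F w = 0 \<and> deriv g w \<noteq> 0" ..
  qed auto
  have h_per: "h (q ^ a * w) = h w" if w: "w \<noteq> 0" for w
  proof -
    have *: "h (q ^ a * w) = h w" if w: "w \<noteq> 0" and gw: "g w \<noteq> 0" for w
    proof -
      have sa: "s powi (- (int a * (int a - 1))) = s ^ a / s ^ (a * a)"
        using s0 power_int_diff[of s "int a" "int a * int a"] by (simp add: algebra_simps flip: of_nat_mult)
      have wa: "w powi (- int a) = 1 / w ^ a" by (simp add: power_int_minus divide_inverse)
      have G: "g (q ^ a * w) = (- 1) ^ a * (s ^ a / s ^ (a * a)) / w ^ a * g w"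
        using qtheta_shift_int[OF s w, of "int a"]
        by (simp add: g_def qs[symmetric] sa wa)
      have TH: "qtheta (q ^ a * w) (q ^ a) = - qtheta w (q ^ a) / w" by (rule qtheta_shift[OF qa w])
      \<comment> \<open>The minus sign from \<open>TH\<close> combines with
        \<open>\<epsilon>\<close>, giving \<open>F\<close> exactly the multiplier of
        \<open>g\<close>.\<close>
      have "(- 1) ^ a = - \<epsilon>" using a by (cases a) (auto simp: \<epsilon>_def)
      hence "F (q ^ a * w) = (- 1) ^ a * (s ^ a / s ^ (a * a)) / w ^ a * F w"
        unfolding F_def f_shift[OF w] TH using w s0 by (simp add: field_simps)
      moreover have "F (q ^ a * w) = g (q ^ a * w) * h (q ^ a * w)" using w q0 by (intro h) auto
      ultimately have "(- 1) ^ a * (s ^ a / s ^ (a * a)) / w ^ a * g w * h (q ^ a * w) = (- 1) ^ a * (s ^ a / s ^ (a * a)) / w ^ a * g w * h w"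
        using h[of w] w by (simp add: G)
      thus ?thesis using w s0 gw by simp
    qed
    \<comment> \<open>The zeros of \<open>g\<close> are isolated, so periodicity extends to them by
      continuity of \<open>h\<close>.\<close>
    have "eventually (\<lambda>v. g v \<noteq> 0) (at w)" unfolding g_def by (rule eventually_qtheta_nonzero[OF q w])
    moreover have "eventually (\<lambda>v. v \<in> - {0}) (at w)" using w by (intro eventually_at_in_open') auto
    ultimately have ev: "eventually (\<lambda>v. h (q ^ a * v) = h v) (at w)"
      by eventually_elim (use * in auto)
    have cont: "isCont h v" if "v \<noteq> 0" for v
      by (rule cont_at[OF h_hol that])
    have "((\<lambda>v. h (q ^ a * v)) \<longlongrightarrow> h (q ^ a * w)) (at w)"
      by (rule isCont_tendsto_compose[OF cont]) (use w q0 in \<open>auto intro!: tendsto_intros\<close>)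
    moreover have "((\<lambda>v. h v) \<longlongrightarrow> h w) (at w)" using cont[OF w] by (simp add: isCont_def)
    hence "((\<lambda>v. h (q ^ a * v)) \<longlongrightarrow> h w) (at w)"
      by (rule Lim_transform_eventually) (use ev in \<open>auto elim: eventually_mono\<close>)
    ultimately show ?thesis by (rule LIM_unique)
  qed
  obtain c where c: "\<And>w. w \<noteq> 0 \<Longrightarrow> h w = c"
    using multiplicatively_periodic_constant[OF h_hol qa h_per] by blast
  have Fc: "f w * qtheta w (q ^ a) = c * qtheta w q" if "w \<noteq> 0" for w
    using h[of w] c[OF that] that by (simp add: F_def g_def)
  \<comment> \<open>The theta product without its factor \<open>1 - w\<close>, so that
    \<open>R p 1 = euler_E p ^ 2\<close>.\<close>
  define R where "R = (\<lambda>p w. qpoch (w * p) p * qpoch (p / w) p)"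
  \<comment> \<open>At \<open>w = 1\<close> both theta products vanish and \<open>Fc\<close> says
    nothing about \<open>c\<close>. Dividing by \<open>1 - w\<close> nearby and passing to the limit
    recovers the information.\<close>
  have f1_sq: "f 1 * euler_E (q ^ a) ^ 2 = c * euler_E q ^ 2"
  proof -
    have "isCont (\<lambda>w. f w * R (q ^ a) w - c * R q w) 1"
    proof -
      have "(\<lambda>w. f w * R (q ^ a) w - c * R q w) holomorphic_on - {0}"
        unfolding R_def using f_hol q qa by (intro holomorphic_intros) auto
      from cont_at[OF this] show ?thesis by simp
    qed
    moreover have "eventually (\<lambda>w. f w * R (q ^ a) w - c * R q w = 0) (at 1)"
    proof -
      have "eventually (\<lambda>w. w \<in> - {0::complex}) (at 1)" by (intro eventually_at_in_open') auto
      moreover have "eventually (\<lambda>w. w \<noteq> (1::complex)) (at 1)" by (simp add: eventually_at_filter)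
      ultimately show ?thesis
      proof eventually_elim
        case (elim w)
        have "(1 - w) * (f w * R (q ^ a) w - c * R q w) = 0"
          using Fc[of w] elim qtheta_factor[OF q(2), of w] qtheta_factor[OF qa(2), of w]
          by (simp add: R_def algebra_simps)
        thus ?case using elim by simp
      qed
    qed
    hence "((\<lambda>w. f w * R (q ^ a) w - c * R q w) \<longlongrightarrow> 0) (at 1)" by (rule tendsto_eventually)
    ultimately have "f 1 * R (q ^ a) 1 - c * R q 1 = 0"
      unfolding isCont_def by (rule LIM_unique)
    thus ?thesis by (simp add: R_def euler_E_eq_qpoch power2_eq_square)
  qed
  have f1: "f 1 * euler_E (q ^ a) = euler_E q ^ a"
    using lattice_sum_omega_0[OF a s] by (simp add: f_def T_def x_def qs)
  have pow: "euler_E q ^ a = euler_E q ^ (a - 2) * euler_E q ^ 2"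
    by (simp only: power_add[symmetric] le_add_diff_inverse2[OF assms(1)])
  have c_eq: "c = euler_E q ^ (a - 2) * euler_E (q ^ a)"
  proof -
    have "c * euler_E q ^ 2 = (f 1 * euler_E (q ^ a)) * euler_E (q ^ a)"
      unfolding f1_sq[symmetric] by (simp add: power2_eq_square)
    also have "\<dots> = (euler_E q ^ (a - 2) * euler_E (q ^ a)) * euler_E q ^ 2"
      unfolding f1 pow by (simp only: mult_ac)
    finally show ?thesis using euler_E_nonzero[OF q(2)] by simp
  qed
  \<comment> \<open>Near \<open>z\<close>, with \<open>z\<close> itself excluded, the denominator is
    nonzero and the product equals \<open>f\<close>. Continuity of \<open>f\<close> makes
    \<open>f z\<close> the limit that \<open>remove_sings\<close> selects, also when
    \<open>z\<close> is a removable singularity.\<close>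
  have "eventually (\<lambda>w. qtheta w (q ^ a) \<noteq> 0) (at z)"
    by (rule eventually_qtheta_nonzero[OF qa assms(5)])
  moreover have "eventually (\<lambda>w. w \<in> - {0}) (at z)" using assms(5) by (intro eventually_at_in_open') auto
  ultimately have "eventually (\<lambda>w. f w = product_side a q w) (at z)"
  proof eventually_elim
    case (elim w)
    hence "f w = c * qtheta w q / qtheta w (q ^ a)" using Fc[of w] by (simp add: eq_divide_eq)
    thus ?case using product_side_eq[OF q a, of w] elim by (simp add: c_eq)
  qed
  moreover have "f \<midarrow>z\<rightarrow> f z"
    using cont_at[OF f_hol assms(5)] by (simp add: isCont_def)
  ultimately have "product_side a q \<midarrow>z\<rightarrow> f z" by (rule Lim_transform_eventually[rotated])
  hence "remove_sings (product_side a q) z = f z" by (rule remove_sings_eqI)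
  thus ?thesis using f_sum by simp
qed

end
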